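(* Let $p$ be a prime, let $\kappa$ be a regular uncountable cardinal, let $A=\prod^{(\kappa)}_{\alpha<\kappa}E_{\alpha+1}$ and $S=S(A)$. Then $S$ is local, $S$ is not $\kappa$-complete, and $\mathrm{len}(S)=\kappa$.
   Context: An inverse sequence of abelian groups $S$ consists of abelian groups $S_i$ and homomorphisms $f_i:S_{i+1}\to S_i$, $i\in\omega=\{0,1,2,\dots\}$. $\lim S$ and $\lim^1S$ are the kernel and the cokernel of $1-F:\prod_iS_i\to\prod_iS_i$, $\mathrm{pr}_jF=f_j\mathrm{pr}_{j+1}$. $S$ is local if $\lim S=\lim^1S=0$. Let $I(S)\subseteq S$ be given by $I(S)_i=\mathrm{Im}(f_i:S_{i+1}\to S_i)$; put $I^0(S)=S$, $I^{\beta+1}(S)=I(I^\beta(S))$, and $I^\lambda(S)=\lim_{\beta<\lambda}I^\beta(S)$ (the componentwise intersection) for a limit ordinal $\lambda$. The length $\mathrm{len}(S)$ is the least ordinal $\mu$ such that $I^\beta(S)\rightarrowtail I^{\mu}(S)$ is an isomorphism for every $\beta>\mu$. Put $S^\beta=S/I^\beta(S)$, and for a limit ordinal $\lambda$ put $\widehat S^\lambda=\lim_{\beta<\lambda}S^\beta$ (componentwise limit). $S$ is $\lambda$-complete if the natural map $S\to\widehat S^\lambda$ is an epimorphism (componentwise surjective). Cardinals are identified with initial ordinals. For an abelian group $A$: $S(A)$ is the inverse sequence with $S(A)_i=A$ and $f_i(a)=pa$ for all $i$. Also $p^0A=A$, $p^{\beta+1}A=p\cdot(p^\beta A)$, and $p^\lambda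 A=\bigcap_{\beta<\lambda}p^\beta A$ for a limit ordinal $\lambda$. For a family of abelian groups $(A_x)_{x\in X}$, the $\kappa$-supported product $\prod^{(\kappa)}_{x\in X}A_x$ is the subgroup of $\prod_{x\in X}A_x$ of elements whose support has cardinality $<\kappa$. Construction of $E_\alpha$ for an ordinal $\alpha$: let $\alpha^\diamond$ be the set of all finite increasing sequences of ordinals $(\alpha_1,\dots,\alpha_n)$ with $\alpha_1<\dots<\alpha_n<\alpha$, $n\ge1$. Let $\mathbb{Z}_p$ be the $p$-adic integers, $P_\alpha=\prod_{\sigma\in\alpha^\diamond}\mathbb{Z}_p$ and $P'_\alpha=\bigoplus_{\sigma\in\alpha^\diamond}\mathbb{Z}_p\subseteq P_\alpha$, with standard basis $(e_\sigma)_{\sigma\in\alpha^\diamond}$ of $P'_\alpha$ over $\mathbb{Z}_p$. Let $R_\alpha\subseteq P'_\alpha$ be the $\mathbb{Z}_p$-submodule generated by the elements $r_{\alpha_1}=pe_{\alpha_1}$ and $r_{\alpha_1,\dots,\alpha_n}=pe_{\alpha_1,\dots,\alpha_n}-e_{\alpha_2,\dots,\alpha_n}$ for $n\ge2$. Put $D_\alpha=P_\alpha/R_\alpha$ and $E_\alpha=D_\alpha/p^\alpha D_\alpha$. *)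

theory Defs
  imports "HOL-Algebra.Product_Groups" "HOL-Algebra.Module" "HOL-Number_Theory.Number_Theory"
begin

unbundle cardinal_syntax

section \<open>Ordinals\<close>

text \<open>
  Ordinals are elements of an arbitrary well-ordered type without a greatest element; such an
  element \<open>\<alpha>\<close> stands for the order type of \<open>{..<\<alpha>}\<close>. Every ordinal occurs in some such type, and a
  type variable of this sort is universally quantified in a theorem, so a quantifier over
  \<open>'o\<close> together with the generality in \<open>'o\<close> ranges over all ordinals.
\<close>

definition osucc :: "'o::{wellorder,no_top} \<Rightarrow> 'o" where
  "osucc \<alpha> = (LEAST \<beta>. \<alpha> < \<beta>)"

lemma less_osucc [simp]: "\<alpha> < osucc \<alpha>"
  unfolding osucc_def using gt_ex by (rule LeastI_ex)

lemma osucc_le_iff: "osucc \<alpha> \<le> \<beta> \<longleftrightarrow> \<alpha> < \<beta>"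
  by (metis Least_le less_osucc order_less_le_trans osucc_def)

lemma less_osucc_iff: "\<beta> < osucc \<alpha> \<longleftrightarrow> \<beta> \<le> \<alpha>"
  by (metis not_le osucc_le_iff)

lemma osucc_inject [simp]: "osucc \<alpha> = osucc \<beta> \<longleftrightarrow> \<alpha> = \<beta>"
  by (metis less_osucc less_osucc_iff order_antisym)

definition is_limit :: "'o::{wellorder,no_top} \<Rightarrow> bool" where
  "is_limit \<alpha> \<longleftrightarrow> (\<exists>\<beta>. \<beta> < \<alpha>) \<and> (\<forall>\<beta>. \<alpha> \<noteq> osucc \<beta>)"

text \<open>The ordinal \<open>\<kappa>\<close> as a well-order relation on the set \<open>{..<\<kappa>}\<close>.\<close>

definition ordinal_rel :: "'o::wellorder \<Rightarrow> 'o rel" where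
  "ordinal_rel \<kappa> = {(\<alpha>, \<beta>). \<alpha> \<le> \<beta> \<and> \<beta> < \<kappa>}"

text \<open>\<^const>\<open>Card_order\<close> says that \<open>\<kappa>\<close> is an initial ordinal.\<close>

definition regular_uncountable_cardinal :: "'o::wellorder \<Rightarrow> bool" where
  "regular_uncountable_cardinal \<kappa> \<longleftrightarrow>
     Card_order (ordinal_rel \<kappa>) \<and> regularCard (ordinal_rel \<kappa>) \<and> natLeq <o ordinal_rel \<kappa>"

function transfinite :: "('b::complete_lattice \<Rightarrow> 'b) \<Rightarrow> 'b \<Rightarrow> 'o::{wellorder,no_top} \<Rightarrow> 'b" where
  "transfinite \<Phi> X \<alpha> =
     (if \<exists>\<beta>. \<alpha> = osucc \<beta> then \<Phi> (transfinite \<Phi> X (THE \<beta>. \<alpha> = osucc \<beta>))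
      else if is_limit \<alpha> then (INF \<beta>\<in>{..<\<alpha>}. transfinite \<Phi> X \<beta>)
      else X)"
  by pat_completeness auto
termination
  by (relation "inv_image {(\<beta>, \<alpha>). \<beta> < \<alpha>} (\<lambda>(\<Phi>, X, \<beta>). \<beta>)") (auto intro: wf_inv_image wf)

declare transfinite.simps [simp del]

lemma transfinite_zero: "(\<And>\<beta>. \<not> \<beta> < \<alpha>) \<Longrightarrow> transfinite \<Phi> X \<alpha> = X"
  by (subst transfinite.simps) (metis is_limit_def less_osucc)

lemma transfinite_osucc: "transfinite \<Phi> X (osucc \<alpha>) = \<Phi> (transfinite \<Phi> X \<alpha>)"
  by (subst transfinite.simps) simp

lemma transfinite_limit: "is_limit \<alpha> \<Longrightarrow> transfinite \<Phi> X \<alpha> = (INF \<beta>\<in>{..<\<alpha>}. transfinite \<Phi> X \<beta>)"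
  by (subst transfinite.simps) (simp add: is_limit_def)


section \<open>Inverse sequences of abelian groups\<close>

text \<open>Abelian groups are multiplicatively written records of the algebra library.\<close>

record 'a inv_seq =
  grp :: "nat \<Rightarrow> 'a monoid"
  bond :: "nat \<Rightarrow> 'a \<Rightarrow> 'a"

definition inverse_sequence :: "'a inv_seq \<Rightarrow> bool" where
  "inverse_sequence S \<longleftrightarrow>
     (\<forall>i. comm_group (grp S i)) \<and> (\<forall>i. bond S i \<in> hom (grp S (Suc i)) (grp S i))"

definition seq_product :: "'a inv_seq \<Rightarrow> (nat \<Rightarrow> 'a) monoid" where
  "seq_product S = product_group UNIV (grp S)"

definition one_minus_F :: "'a inv_seq \<Rightarrow> (nat \<Rightarrow> 'a) \<Rightarrow> (nat \<Rightarrow> 'a)" where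
  "one_minus_F S x =
     x \<otimes>\<^bsub>seq_product S\<^esub> inv\<^bsub>seq_product S\<^esub> (\<lambda>j. bond S j (x (Suc j)))"

definition lim0 :: "'a inv_seq \<Rightarrow> (nat \<Rightarrow> 'a) monoid" where
  "lim0 S = (seq_product S)\<lparr>carrier := kernel (seq_product S) (seq_product S) (one_minus_F S)\<rparr>"

definition lim1 :: "'a inv_seq \<Rightarrow> (nat \<Rightarrow> 'a) set monoid" where
  "lim1 S = seq_product S Mod (one_minus_F S ` carrier (seq_product S))"

definition local_seq :: "'a inv_seq \<Rightarrow> bool" where
  "local_seq S \<longleftrightarrow> trivial_group (lim0 S) \<and> trivial_group (lim1 S)"

text \<open>
  \<open>I_pow S \<beta> i\<close> is the carrier of \<open>I\<^sup>\<beta>(S)\<^sub>i\<close> as a subgroup of \<open>S\<^sub>i\<close>; limits are componentwise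
  intersections because infima of functions are pointwise.
\<close>

definition I_pow :: "'a inv_seq \<Rightarrow> 'o::{wellorder,no_top} \<Rightarrow> nat \<Rightarrow> 'a set" where
  "I_pow S = transfinite (\<lambda>T i. bond S i ` T (Suc i)) (\<lambda>i. carrier (grp S i))"

definition I_grp :: "'a inv_seq \<Rightarrow> 'o::{wellorder,no_top} \<Rightarrow> nat \<Rightarrow> 'a monoid" where
  "I_grp S \<beta> i = (grp S i)\<lparr>carrier := I_pow S \<beta> i\<rparr>"

definition stable_at :: "'a inv_seq \<Rightarrow> 'o::{wellorder,no_top} \<Rightarrow> bool" where
  "stable_at S \<mu> \<longleftrightarrow> (\<forall>\<beta>>\<mu>. \<forall>i. (\<lambda>x. x) \<in> iso (I_grp S \<beta> i) (I_grp S \<mu> i))"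

text \<open>\<open>has_len S \<mu>\<close> is \<open>len(S) = \<mu>\<close>; a relation, so that the least ordinal is claimed to exist.\<close>

definition has_len :: "'a inv_seq \<Rightarrow> 'o::{wellorder,no_top} \<Rightarrow> bool" where
  "has_len S \<mu> \<longleftrightarrow> stable_at S \<mu> \<and> (\<forall>\<nu>. stable_at S \<nu> \<longrightarrow> \<mu> \<le> \<nu>)"

definition seq_quot :: "'a inv_seq \<Rightarrow> 'o::{wellorder,no_top} \<Rightarrow> nat \<Rightarrow> 'a set monoid" where
  "seq_quot S \<beta> i = grp S i Mod I_pow S \<beta> i"

text \<open>
  The completion at stage \<open>i\<close>: compatible families of cosets. For \<open>\<gamma> < \<beta>\<close> the projection
  \<open>S\<^sub>i/I\<^sup>\<beta>(S)\<^sub>i \<rightarrow> S\<^sub>i/I\<^sup>\<gamma>(S)\<^sub>i\<close> sends a coset \<open>C\<close> to \<open>I\<^sup>\<gamma>(S)\<^sub>i + C\<close>.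
\<close>

definition completion :: "'a inv_seq \<Rightarrow> 'o::{wellorder,no_top} \<Rightarrow> nat \<Rightarrow> ('o \<Rightarrow> 'a set) monoid" where
  "completion S \<mu> i = (product_group {..<\<mu>} (\<lambda>\<beta>. seq_quot S \<beta> i))
     \<lparr>carrier := {c \<in> carrier (product_group {..<\<mu>} (\<lambda>\<beta>. seq_quot S \<beta> i)).
        \<forall>\<beta><\<mu>. \<forall>\<gamma><\<beta>. I_pow S \<gamma> i <#>\<^bsub>grp S i\<^esub> c \<beta> = c \<gamma>}\<rparr>"

definition to_completion :: "'a inv_seq \<Rightarrow> 'o::{wellorder,no_top} \<Rightarrow> nat \<Rightarrow> 'a \<Rightarrow> ('o \<Rightarrow> 'a set)" where
  "to_completion S \<mu> i x = (\<lambda>\<beta>\<in>{..<\<mu>}. I_pow S \<beta> i #>\<^bsub>grp S i\<^esub> x)"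

definition complete_at :: "'a inv_seq \<Rightarrow> 'o::{wellorder,no_top} \<Rightarrow> bool" where
  "complete_at S \<mu> \<longleftrightarrow>
     (\<forall>i. to_completion S \<mu> i ` carrier (grp S i) = carrier (completion S \<mu> i))"

definition mult_seq :: "nat \<Rightarrow> 'a monoid \<Rightarrow> 'a inv_seq" where
  "mult_seq p A = \<lparr>grp = (\<lambda>i. A), bond = (\<lambda>i a. a [^]\<^bsub>A\<^esub> p)\<rparr>"

lemma inverse_sequence_mult_seq: "comm_group A \<Longrightarrow> inverse_sequence (mult_seq p A)"
  by (auto simp: inverse_sequence_def mult_seq_def hom_def comm_group_def group_def
      comm_monoid.nat_pow_distrib monoid.nat_pow_closed)


section \<open>Transfinite multiples and supported products\<close>

definition p_pow :: "nat \<Rightarrow> ('a, 'b) monoid_scheme \<Rightarrow> 'o::{wellorder,no_top} \<Rightarrow> 'a set" where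
  "p_pow p A = transfinite (\<lambda>B. (\<lambda>a. a [^]\<^bsub>A\<^esub> p) ` B) (carrier A)"

definition supported_product ::
    "'o::wellorder \<Rightarrow> 'i set \<Rightarrow> ('i \<Rightarrow> ('a, 'b) monoid_scheme) \<Rightarrow> ('i \<Rightarrow> 'a) monoid" where
  "supported_product \<kappa> X A = (product_group X A)
     \<lparr>carrier := {f \<in> carrier (product_group X A).
        |{x \<in> X. f x \<noteq> \<one>\<^bsub>A x\<^esub>}| <o ordinal_rel \<kappa>}\<rparr>"


section \<open>The groups \<open>E\<^sub>\<alpha>\<close>\<close>

text \<open>\<open>\<int>\<^sub>p\<close> as the inverse limit of the rings \<open>\<int>/p\<^sup>n\<close>, whose elements are represented by \<open>{0..<p\<^sup>n}\<close>.\<close>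

definition padic_int :: "nat \<Rightarrow> (nat \<Rightarrow> int) ring" where
  "padic_int p = \<lparr>
     carrier = {x. \<forall>n. x n \<in> {0..<int p ^ n} \<and> x (Suc n) mod int p ^ n = x n},
     monoid.mult = (\<lambda>x y n. (x n * y n) mod int p ^ n),
     one = (\<lambda>n. 1 mod int p ^ n),
     zero = (\<lambda>n. 0),
     add = (\<lambda>x y n. (x n + y n) mod int p ^ n)\<rparr>"

definition diamond :: "'o::wellorder \<Rightarrow> 'o list set" where
  "diamond \<alpha> = {\<sigma>. \<sigma> \<noteq> [] \<and> sorted_wrt (<) \<sigma> \<and> set \<sigma> \<subseteq> {..<\<alpha>}}"

text \<open>The product \<open>R\<^sup>X\<close> as an \<open>R\<close>-module (module records also carry a multiplication).\<close>

definition product_module :: "('r, 'm) ring_scheme \<Rightarrow> 'x set \<Rightarrow> ('r, 'x \<Rightarrow> 'r) module" where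
  "product_module R X = \<lparr>
     carrier = (\<Pi>\<^sub>E x\<in>X. carrier R),
     monoid.mult = (\<lambda>f g. \<lambda>x\<in>X. f x \<otimes>\<^bsub>R\<^esub> g x),
     one = (\<lambda>x\<in>X. \<one>\<^bsub>R\<^esub>),
     zero = (\<lambda>x\<in>X. \<zero>\<^bsub>R\<^esub>),
     add = (\<lambda>f g. \<lambda>x\<in>X. f x \<oplus>\<^bsub>R\<^esub> g x),
     smult = (\<lambda>a f. \<lambda>x\<in>X. a \<otimes>\<^bsub>R\<^esub> f x)\<rparr>"

definition P_mod :: "nat \<Rightarrow> 'o::wellorder \<Rightarrow> (nat \<Rightarrow> int, 'o list \<Rightarrow> nat \<Rightarrow> int) module" where
  "P_mod p \<alpha> = product_module (padic_int p) (diamond \<alpha>)"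

definition basis_elem :: "nat \<Rightarrow> 'o::wellorder \<Rightarrow> 'o list \<Rightarrow> ('o list \<Rightarrow> nat \<Rightarrow> int)" where
  "basis_elem p \<alpha> \<sigma> =
     (\<lambda>\<tau>\<in>diamond \<alpha>. if \<tau> = \<sigma> then \<one>\<^bsub>padic_int p\<^esub> else \<zero>\<^bsub>padic_int p\<^esub>)"

definition relator :: "nat \<Rightarrow> 'o::wellorder \<Rightarrow> 'o list \<Rightarrow> ('o list \<Rightarrow> nat \<Rightarrow> int)" where
  "relator p \<alpha> \<sigma> =
     (if length \<sigma> = 1 then [p] \<cdot>\<^bsub>P_mod p \<alpha>\<^esub> basis_elem p \<alpha> \<sigma>
      else [p] \<cdot>\<^bsub>P_mod p \<alpha>\<^esub> basis_elem p \<alpha> \<sigma> \<ominus>\<^bsub>P_mod p \<alpha>\<^esub> basis_elem p \<alpha> (tl \<sigma>))"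

text \<open>
  The submodule generated by the relators inside \<open>P\<^sub>\<alpha>\<close> is the one generated inside the direct sum
  \<open>P'\<^sub>\<alpha>\<close>, because \<open>P'\<^sub>\<alpha>\<close> is a submodule containing them.
\<close>

definition R_sub :: "nat \<Rightarrow> 'o::wellorder \<Rightarrow> ('o list \<Rightarrow> nat \<Rightarrow> int) set" where
  "R_sub p \<alpha> = (\<lambda>H. submodule H (padic_int p) (P_mod p \<alpha>)) hull (relator p \<alpha> ` diamond \<alpha>)"

definition D_grp :: "nat \<Rightarrow> 'o::wellorder \<Rightarrow> ('o list \<Rightarrow> nat \<Rightarrow> int) set monoid" where
  "D_grp p \<alpha> = add_monoid (P_mod p \<alpha>) Mod R_sub p \<alpha>"

definition E_grp :: "nat \<Rightarrow> 'o::{wellorder,no_top} \<Rightarrow> ('o list \<Rightarrow> nat \<Rightarrow> int) set set monoid" where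
  "E_grp p \<alpha> = D_grp p \<alpha> Mod p_pow p (D_grp p \<alpha>) \<alpha>"

end

theory Submission
  imports Defs "HOL-Library.Sublist"
begin

text \<open>
  The group \<open>P\<^sub>\<alpha>\<close> is \<open>p\<close>-adically complete, so \<open>1 - F\<close> is onto for \<open>S(P\<^sub>\<alpha>)\<close>, hence for its quotients
  \<open>S(E\<^sub>\<alpha>)\<close>, and also for \<open>S(A)\<close>, because by regularity of \<open>\<kappa>\<close> the union of countably many supports
  is again small. As \<open>p\<^sup>\<beta>A\<close> is computed componentwise and \<open>p\<^bsup>\<alpha>+1\<^esup>E\<^bsub>\<alpha>+1\<^esub> = 0\<close>, we have \<open>p\<^sup>\<kappa>A = 0\<close>, which
  gives \<open>lim S = 0\<close> and \<open>len S \<le> \<kappa>\<close>.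

  The class of \<open>e\<^bsub>(\<nu>)\<^esub>\<close> lies in \<open>p\<^sup>\<nu>D\<^bsub>\<nu>+1\<^esub>\<close> because \<open>p e\<^bsub>(\<beta>,\<sigma>)\<^esub> = e\<^sub>\<sigma>\<close>. It is not in \<open>p\<^bsup>\<nu>+1\<^esup>D\<^bsub>\<nu>+1\<^esub>\<close>: over
  \<open>\<rat>\<^sub>p\<close> the relators form a basis of the finitely supported vectors, and by transfinite induction a
  finitely supported \<open>x\<close> with class in \<open>p\<^sup>\<beta>D\<^sub>\<alpha>\<close> has integral coefficients at all \<open>\<sigma>\<close> with
  \<open>\<sigma>\<^sub>1 < \<beta>\<close>, whereas the coefficient of \<open>e\<^bsub>(\<nu>)\<^esub>\<close> at \<open>(\<nu>)\<close> is \<open>1/p\<close>. Hence \<open>p\<^sup>\<nu>A \<noteq> 0\<close> for \<open>\<nu> < \<kappa>\<close>. The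
  truncations of the family \<open>(e\<^bsub>(\<nu>)\<^esub>)\<^bsub>\<nu><\<kappa>\<^esub>\<close> are compatible, but their only possible limit has full
  support.
\<close>

section \<open>Case analysis and induction on ordinals\<close>

lemma ordinal_cases [case_names zero succ limit]:
  fixes \<alpha> :: "'o::{wellorder,no_top}"
  obtains "\<And>\<beta>. \<not> \<beta> < \<alpha>" | \<beta> where "\<alpha> = osucc \<beta>" | "is_limit \<alpha>"
  unfolding is_limit_def by blast

lemma ordinal_induct [case_names zero succ limit]:
  fixes \<alpha> :: "'o::{wellorder,no_top}"
  assumes "\<And>\<alpha>. (\<And>\<beta>. \<not> \<beta> < \<alpha>) \<Longrightarrow> P \<alpha>"
    and "\<And>\<alpha>. P \<alpha> \<Longrightarrow> P (osucc \<alpha>)"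
    and "\<And>\<alpha>. is_limit \<alpha> \<Longrightarrow> (\<And>\<beta>. \<beta> < \<alpha> \<Longrightarrow> P \<beta>) \<Longrightarrow> P \<alpha>"
  shows "P \<alpha>"
proof (induction \<alpha> rule: less_induct)
  case (less \<alpha>)
  show ?case
    by (cases \<alpha> rule: ordinal_cases) (use assms less in auto)
qed

lemma is_limit_osucc_less: "is_limit \<alpha> \<Longrightarrow> \<beta> < \<alpha> \<Longrightarrow> osucc \<beta> < \<alpha>"
  by (metis is_limit_def osucc_le_iff order_le_less)


section \<open>Transfinite multiples\<close>

lemma p_pow_zero: "(\<And>\<beta>. \<not> \<beta> < \<alpha>) \<Longrightarrow> p_pow p G \<alpha> = carrier G"
  unfolding p_pow_def by (rule transfinite_zero)

lemma p_pow_osucc: "p_pow p G (osucc \<alpha>) = (\<lambda>a. a [^]\<^bsub>G\<^esub> p) ` p_pow p G \<alpha>"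
  unfolding p_pow_def by (rule transfinite_osucc)

lemma p_pow_limit: "is_limit \<alpha> \<Longrightarrow> p_pow p G \<alpha> = (\<Inter>\<beta><\<alpha>. p_pow p G \<beta>)"
  unfolding p_pow_def by (rule transfinite_limit)

lemma (in comm_group) nat_pow_hom: "(\<lambda>a. a [^] (n::nat)) \<in> hom G G"
  by (rule homI) (simp_all add: nat_pow_distrib)

lemma (in comm_group) subgroup_p_pow: "subgroup (p_pow p G \<alpha>) G"
proof (induction \<alpha> rule: ordinal_induct)
  case (zero \<alpha>)
  then show ?case by (simp add: p_pow_zero subgroup_self)
next
  case (succ \<alpha>)
  interpret pow: group_hom G G "\<lambda>a. a [^] p"
    using nat_pow_hom by unfold_locales
  show ?case
    unfolding p_pow_osucc using succ by (rule pow.subgroup_img_is_subgroup)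
next
  case (limit \<alpha>)
  then show ?case
    unfolding p_pow_limit [OF limit(1)] by (intro subgroups_Inter) (auto simp: is_limit_def)
qed

lemma (in comm_group) p_pow_closed: "x \<in> p_pow p G \<alpha> \<Longrightarrow> x \<in> carrier G"
  using subgroup.mem_carrier subgroup_p_pow .

lemma (in comm_group) nat_pow_mem_p_pow: "x \<in> p_pow p G \<alpha> \<Longrightarrow> x [^] (n::nat) \<in> p_pow p G \<alpha>"
  by (induction n) (auto intro: subgroup.m_closed subgroup.one_closed subgroup_p_pow)

lemma (in comm_group) p_pow_antimono: "\<beta> \<le> \<alpha> \<Longrightarrow> p_pow p G \<alpha> \<subseteq> p_pow p G \<beta>"
proof (induction \<alpha> rule: ordinal_induct)
  case (zero \<alpha>)
  then show ?case by (metis order_le_less subset_refl)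
next
  case (succ \<alpha>)
  have "p_pow p G (osucc \<alpha>) \<subseteq> p_pow p G \<alpha>"
    unfolding p_pow_osucc using nat_pow_mem_p_pow by blast
  with succ show ?case
    by (metis less_osucc_iff order_le_less order_trans subset_refl)
next
  case (limit \<alpha>)
  then show ?case
    by (cases "\<beta> = \<alpha>") (auto simp: p_pow_limit [OF limit(1)])
qed

text \<open>A homomorphism commutes with multiplication by p, so it cannot lower heights. The
  application is to quotient maps.\<close>

lemma (in comm_group) p_pow_hom:
  assumes "group H" "f \<in> hom G H"
  shows "f ` p_pow p G \<alpha> \<subseteq> p_pow p H \<alpha>"
proof (induction \<alpha> rule: ordinal_induct)
  case (zero \<alpha>)
  then show ?case using assms by (auto simp: p_pow_zero hom_def)
next
  case (succ \<alpha>)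
  then show ?case
    using assms p_pow_closed [of _ p \<alpha>] by (auto simp: p_pow_osucc hom_nat_pow is_group)
next
  case (limit \<alpha>)
  then show ?case by (fastforce simp: p_pow_limit)
qed

lemma carrier_FactGroupE:
  assumes "C \<in> carrier (G Mod N)"
  obtains x where "x \<in> carrier G" "C = N #>\<^bsub>G\<^esub> x"
  using assms by (auto simp: carrier_FactGroup)

lemma (in comm_group) r_coset_mem_p_pow_Mod:
  assumes "subgroup N G" "x \<in> p_pow p G \<alpha>"
  shows "N #> x \<in> p_pow p (G Mod N) \<alpha>"
proof -
  interpret N: normal N G using assms(1) by (rule subgroup_imp_normal)
  show ?thesis
    using p_pow_hom [OF N.factorgroup_is_group N.r_coset_hom_Mod] assms(2) by blast
qed

text \<open>Dividing by \<open>p_pow p G \<alpha>\<close> raises no height up to \<alpha>: in the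
  successor step a representative is corrected by an element n of this subgroup, and n already lies
  in \<open>p_pow p G (osucc \<beta>)\<close> because
  \<open>osucc \<beta> \<le> \<alpha>\<close>.\<close>

lemma (in comm_group) p_pow_Mod_p_pow:
  assumes "\<beta> \<le> \<alpha>" "x \<in> carrier G" "p_pow p G \<alpha> #> x \<in> p_pow p (G Mod p_pow p G \<alpha>) \<beta>"
  shows "x \<in> p_pow p G \<beta>"
  using assms
proof (induction \<beta> arbitrary: x rule: ordinal_induct)
  case (zero \<beta>)
  then show ?case by (simp add: p_pow_zero)
next
  case (succ \<beta>)
  let ?N = "p_pow p G \<alpha>"
  interpret N: normal ?N G using subgroup_p_pow by (rule subgroup_imp_normal)
  interpret Q: comm_group "G Mod ?N" using subgroup_p_pow by (rule abelian_FactGroup)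
  from succ.prems(3) obtain C where C: "C \<in> p_pow p (G Mod ?N) \<beta>"
    and eq: "?N #> x = C [^]\<^bsub>G Mod ?N\<^esub> p"
    unfolding p_pow_osucc by blast
  obtain y where y: "y \<in> carrier G" "C = ?N #> y"
    using Q.p_pow_closed [OF C] by (rule carrier_FactGroupE)
  have "\<beta> \<le> \<alpha>" using succ.prems(1) by (simp add: osucc_le_iff)
  then have y': "y \<in> p_pow p G \<beta>"
    using C unfolding y(2) by (rule succ.IH [OF _ y(1)])
  have "?N #> x = ?N #> (y [^] p)"
    using eq y by (simp add: N.FactGroup_pow)
  then have "x \<in> ?N #> (y [^] p)"
    using rcos_self [OF succ.prems(2) N.subgroup_axioms] by simp
  then obtain n where n: "n \<in> ?N" "x = n \<otimes> y [^] p"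
    by (auto simp: r_coset_def)
  have "n \<in> p_pow p G (osucc \<beta>)" "y [^] p \<in> p_pow p G (osucc \<beta>)"
    using n(1) p_pow_antimono [OF succ.prems(1)] y' by (auto simp: p_pow_osucc)
  then show ?case
    unfolding n(2) using subgroup.m_closed subgroup_p_pow by metis
next
  case (limit \<beta>)
  then show ?case
    by (auto simp: p_pow_limit intro!: limit.IH)
qed

text \<open>By the previous lemma with \<beta> = \<alpha>, every representative lies in the subgroup
  that is divided out. Applied to \<open>D_grp\<close>, this kills the \<alpha>-th multiple of
  \<open>E_grp p \<alpha>\<close>.\<close>

lemma (in comm_group) p_pow_Mod_p_pow_trivial:
  "p_pow p (G Mod p_pow p G \<alpha>) \<alpha> = {\<one>\<^bsub>G Mod p_pow p G \<alpha>\<^esub>}"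
proof -
  let ?N = "p_pow p G \<alpha>"
  interpret Q: comm_group "G Mod ?N" using subgroup_p_pow by (rule abelian_FactGroup)
  have "C = ?N" if C: "C \<in> p_pow p (G Mod ?N) \<alpha>" for C
  proof -
    obtain y where y: "y \<in> carrier G" "C = ?N #> y"
      using Q.p_pow_closed [OF C] by (rule carrier_FactGroupE)
    then have "y \<in> ?N" using p_pow_Mod_p_pow C by blast
    then show ?thesis using y coset_join2 subgroup_p_pow by metis
  qed
  moreover have "?N \<in> p_pow p (G Mod ?N) \<alpha>"
    using subgroup.one_closed [OF Q.subgroup_p_pow] by simp
  ultimately show ?thesis by auto
qed


section \<open>Local inverse sequences\<close>

text \<open>All stages carry the same group and the same map. The index i is generalised because
  stage i of a successor is computed from stage i + 1.\<close>

lemma I_pow_mult_seq: "I_pow (mult_seq p G) \<alpha> i = p_pow p G \<alpha>"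
proof (induction \<alpha> arbitrary: i rule: ordinal_induct)
  case (zero \<alpha>)
  then show ?case by (simp add: I_pow_def transfinite_zero p_pow_zero mult_seq_def)
next
  case (succ \<alpha>)
  then show ?case
    by (simp add: I_pow_def transfinite_osucc p_pow_osucc) (simp add: mult_seq_def)
next
  case (limit \<alpha>)
  then show ?case by (simp add: I_pow_def transfinite_limit p_pow_limit)
qed

text \<open>Surjectivity of \<open>1 - F\<close> for \<^term>\<open>mult_seq p G\<close>, written multiplicatively and without inverses.\<close>

definition shift_solvable :: "nat \<Rightarrow> ('a, 'b) monoid_scheme \<Rightarrow> bool" where
  "shift_solvable p G \<longleftrightarrow>
     (\<forall>a :: nat \<Rightarrow> 'a. (\<forall>i. a i \<in> carrier G) \<longrightarrow>
        (\<exists>x. \<forall>i. x i \<in> carrier G \<and> x i = a i \<otimes>\<^bsub>G\<^esub> x (Suc i) [^]\<^bsub>G\<^esub> p))"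

text \<open>Solve the equations for representatives of the cosets and project the solution.\<close>

lemma shift_solvable_Mod:
  fixes G (structure)
  assumes "comm_group G" "subgroup N G" "shift_solvable p G"
  shows "shift_solvable p (G Mod N)"
  unfolding shift_solvable_def
proof (intro allI impI)
  interpret comm_group G by fact
  interpret N: normal N G using assms(2) by (rule subgroup_imp_normal)
  fix a :: "nat \<Rightarrow> 'a set" assume "\<forall>i. a i \<in> carrier (G Mod N)"
  then have "\<forall>i. \<exists>b. b \<in> carrier G \<and> a i = N #> b"
    using carrier_FactGroupE by metis
  then obtain b where b: "\<And>i. b i \<in> carrier G" "\<And>i. a i = N #> b i" by metis
  then obtain x where x: "\<And>i::nat. x i \<in> carrier G" "\<And>i. x i = b i \<otimes> x (Suc i) [^] p"
    using assms(3) unfolding shift_solvable_def by metis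
  have eq: "N #> x i = a i \<otimes>\<^bsub>G Mod N\<^esub> (N #> x (Suc i)) [^]\<^bsub>G Mod N\<^esub> p" for i
    by (subst x(2)) (simp add: b x(1) N.FactGroup_pow N.rcos_sum)
  have mem: "N #> x i \<in> carrier (G Mod N)" for i
    using x(1) by (simp add: carrier_FactGroup)
  show "\<exists>x. \<forall>i. x i \<in> carrier (G Mod N) \<and>
      x i = a i \<otimes>\<^bsub>G Mod N\<^esub> x (Suc i) [^]\<^bsub>G Mod N\<^esub> p"
    by (intro exI [of _ "\<lambda>i. N #> x i"] allI conjI mem eq)
qed

text \<open>The entries of an element of the kernel of 1 - F are divisible along the sequence
  itself, so they lie in every transfinite multiple. Solvability makes 1 - F onto, so its cokernel
  is trivial.\<close>

lemma local_mult_seqI: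
  fixes G (structure) and \<alpha> :: "'o::{wellorder,no_top}"
  assumes "comm_group G" "p_pow p G \<alpha> = {\<one>}" "shift_solvable p G"
  shows "local_seq (mult_seq p G)"
proof -
  interpret comm_group G by fact
  let ?S = "mult_seq p G" and ?Q = "seq_product (mult_seq p G)"
  have Q: "?Q = product_group UNIV (\<lambda>i. G)"
    by (simp add: seq_product_def mult_seq_def)
  interpret Q: group ?Q unfolding Q by simp
  have carr: "x \<in> carrier ?Q \<longleftrightarrow> (\<forall>i. x i \<in> carrier G)" for x
    by (auto simp: Q PiE_iff)
  have F: "one_minus_F ?S x = (\<lambda>j. x j \<otimes> inv (x (Suc j) [^] p))" if "x \<in> carrier ?Q" for x
  proof -
    have "inv\<^bsub>?Q\<^esub> (\<lambda>j. x (Suc j) [^] p) = (\<lambda>j. inv (x (Suc j) [^] p))"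
      using that unfolding carr Q by (subst inv_product_group) (auto simp: PiE_iff)
    then show ?thesis
      unfolding one_minus_F_def by (simp add: mult_seq_def seq_product_def restrict_def)
  qed
  have triv: "x = \<one>\<^bsub>?Q\<^esub>" if x: "x \<in> carrier ?Q" "one_minus_F ?S x = \<one>\<^bsub>?Q\<^esub>" for x
  proof -
    have xc: "x i \<in> carrier G" for i using x(1) carr by blast
    have eq: "x i = x (Suc i) [^] p" for i
    proof -
      have "x i \<otimes> inv (x (Suc i) [^] p) = \<one>"
        using fun_cong [OF x(2), of i] unfolding F [OF x(1)] by (simp add: Q)
      then show ?thesis
        using xc by (metis inv_solve_right l_one nat_pow_closed one_closed)
    qed
    \<comment> \<open>All stages are treated at once: entry i is p times entry i + 1, so a successor
      step at i uses the hypothesis at i + 1.\<close>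
    have "x i \<in> p_pow p G \<beta>" for i and \<beta> :: 'o
    proof (induction \<beta> arbitrary: i rule: ordinal_induct)
      case (succ \<beta>)
      show ?case
        unfolding p_pow_osucc by (rule image_eqI [where x = "x (Suc i)"]) (fact eq, fact succ)
    qed (auto simp: p_pow_zero p_pow_limit xc)
    then have "x i = \<one>" for i using assms(2) by blast
    then show ?thesis by (auto simp: Q)
  qed
  have "\<one>\<^bsub>?Q\<^esub> \<in> kernel ?Q ?Q (one_minus_F ?S)"
    unfolding kernel_def using F [OF Q.one_closed] by (auto simp: Q)
  with triv have "carrier (lim0 ?S) = {\<one>\<^bsub>?Q\<^esub>}"
    by (auto simp: lim0_def kernel_def)
  then have "trivial_group (lim0 ?S)"
    using Q.subgroup_imp_group [OF Q.triv_subgroup]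
    unfolding trivial_group_def by (simp add: lim0_def)
  moreover have "trivial_group (lim1 ?S)"
  proof -
    have "b \<in> one_minus_F ?S ` carrier ?Q" if b: "b \<in> carrier ?Q" for b
    proof -
      obtain x where x: "\<And>i::nat. x i \<in> carrier G" "\<And>i. x i = b i \<otimes> x (Suc i) [^] p"
        using assms(3) b unfolding shift_solvable_def carr by metis
      have "one_minus_F ?S x = b"
      proof
        fix i
        have "x i \<otimes> inv (x (Suc i) [^] p) = b i"
          using x b unfolding carr by (metis inv_solve_right' m_closed nat_pow_closed)
        then show "one_minus_F ?S x i = b i"
          using F x(1) carr by metis
      qed
      then show ?thesis using x(1) carr by blast
    qed
    moreover have "one_minus_F ?S x \<in> carrier ?Q" if "x \<in> carrier ?Q" for x
      unfolding F [OF that] using that by (simp add: carr)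
    ultimately have im: "one_minus_F ?S ` carrier ?Q = carrier ?Q" by blast
    interpret N: normal "carrier ?Q" ?Q
      using Q.normal_inv_iff Q.subgroup_self by fastforce
    have "carrier (?Q Mod carrier ?Q) = {carrier ?Q}"
      using Q.coset_join2 [OF _ Q.subgroup_self] Q.one_closed
      unfolding carrier_FactGroup by (auto simp: image_iff)
    then show ?thesis
      unfolding lim1_def im trivial_group_def using N.factorgroup_is_group by simp
  qed
  ultimately show ?thesis by (simp add: local_seq_def)
qed

section \<open>The modules \<open>P\<^sub>\<alpha>\<close>\<close>

lemma padic_int_carrier:
  "x \<in> carrier (padic_int p) \<longleftrightarrow> (\<forall>n. x n \<in> {0..<int p ^ n} \<and> x (Suc n) mod int p ^ n = x n)"
  by (simp add: padic_int_def)

lemma padic_int_mod: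
  assumes "x \<in> carrier (padic_int p)" "m \<le> n"
  shows "x n mod int p ^ m = x m"
  using assms(2)
proof (induction n rule: dec_induct)
  case base
  then show ?case using assms(1) unfolding padic_int_carrier by (metis mod_pos_pos_trivial atLeastLessThan_iff)
next
  case (step n)
  have "x (Suc n) mod int p ^ m = (x (Suc n) mod int p ^ n) mod int p ^ m"
    using step(1) by (simp add: mod_mod_cancel le_imp_power_dvd)
  then show ?case using step assms(1) by (simp add: padic_int_carrier)
qed

lemma padic_int_mod_self [simp]: "x \<in> carrier (padic_int p) \<Longrightarrow> x n mod int p ^ n = x n"
  by (simp add: padic_int_mod)

text \<open>Reduces closure of the p-adic operations to congruences between unreduced
  integers.\<close>

lemma mod_mem_padic_int:
  assumes "0 < p" "\<And>n. [u (Suc n) = u n] (mod int p ^ n)"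
  shows "(\<lambda>n. u n mod int p ^ n) \<in> carrier (padic_int p)"
  using assms by (auto simp: padic_int_carrier cong_def mod_mod_cancel le_imp_power_dvd)

lemma cong_padic_int_Suc: "x \<in> carrier (padic_int p) \<Longrightarrow> [x (Suc n) = x n] (mod int p ^ n)"
  by (simp add: cong_def padic_int_mod)

lemma padic_int_ops:
  "\<zero>\<^bsub>padic_int p\<^esub> = (\<lambda>n. 0)" "\<one>\<^bsub>padic_int p\<^esub> = (\<lambda>n. 1 mod int p ^ n)"
  "x \<oplus>\<^bsub>padic_int p\<^esub> y = (\<lambda>n. (x n + y n) mod int p ^ n)"
  "x \<otimes>\<^bsub>padic_int p\<^esub> y = (\<lambda>n. (x n * y n) mod int p ^ n)"
  by (simp_all add: padic_int_def)

abbreviation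
  "P_add p \<alpha> \<equiv> add_monoid (P_mod p \<alpha>)"

lemma P_mod_carrier: "carrier (P_mod p \<alpha>) = (\<Pi>\<^sub>E \<sigma>\<in>diamond \<alpha>. carrier (padic_int p))"
  by (simp add: P_mod_def product_module_def)

lemma P_mod_ops:
  "\<zero>\<^bsub>P_mod p \<alpha>\<^esub> = (\<lambda>\<sigma>\<in>diamond \<alpha>. \<lambda>n. 0)"
  "x \<oplus>\<^bsub>P_mod p \<alpha>\<^esub> y = (\<lambda>\<sigma>\<in>diamond \<alpha>. \<lambda>n. (x \<sigma> n + y \<sigma> n) mod int p ^ n)"
  "c \<odot>\<^bsub>P_mod p \<alpha>\<^esub> x = (\<lambda>\<sigma>\<in>diamond \<alpha>. \<lambda>n. (c n * x \<sigma> n) mod int p ^ n)"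
  by (simp_all add: P_mod_def product_module_def padic_int_ops)

lemma P_mod_memD: "x \<in> carrier (P_mod p \<alpha>) \<Longrightarrow> \<sigma> \<in> diamond \<alpha> \<Longrightarrow> x \<sigma> \<in> carrier (padic_int p)"
  by (auto simp: P_mod_carrier)

text \<open>Residues are normalised, so congruence at every level forces equality.\<close>

lemma P_mod_eqI:
  assumes "x \<in> carrier (P_mod p \<alpha>)" "y \<in> carrier (P_mod p \<alpha>)"
    "\<And>\<sigma> n. \<sigma> \<in> diamond \<alpha> \<Longrightarrow> [x \<sigma> n = y \<sigma> n] (mod int p ^ n)"
  shows "x = y"
proof (rule PiE_ext [OF assms(1,2) [unfolded P_mod_carrier]])
  fix \<sigma> assume \<sigma>: "\<sigma> \<in> diamond \<alpha>"
  show "x \<sigma> = y \<sigma>"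
  proof
    fix n show "x \<sigma> n = y \<sigma> n"
      using assms(3) [OF \<sigma>, of n] P_mod_memD [OF assms(1) \<sigma>] P_mod_memD [OF assms(2) \<sigma>]
      by (simp add: cong_def)
  qed
qed

lemma P_mod_memI:
  assumes "0 < p" "\<And>\<sigma> n. \<sigma> \<in> diamond \<alpha> \<Longrightarrow> [u \<sigma> (Suc n) = u \<sigma> n] (mod int p ^ n)"
  shows "(\<lambda>\<sigma>\<in>diamond \<alpha>. \<lambda>n. u \<sigma> n mod int p ^ n) \<in> carrier (P_mod p \<alpha>)"
  unfolding P_mod_carrier using assms by (auto intro!: mod_mem_padic_int)

lemma cong_P_mod_Suc:
  "x \<in> carrier (P_mod p \<alpha>) \<Longrightarrow> \<sigma> \<in> diamond \<alpha> \<Longrightarrow> [x \<sigma> (Suc n) = x \<sigma> n] (mod int p ^ n)"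
  by (simp add: P_mod_memD cong_padic_int_Suc)

lemma P_mod_add_closed:
  "0 < p \<Longrightarrow> x \<in> carrier (P_mod p \<alpha>) \<Longrightarrow> y \<in> carrier (P_mod p \<alpha>) \<Longrightarrow>
    x \<oplus>\<^bsub>P_mod p \<alpha>\<^esub> y \<in> carrier (P_mod p \<alpha>)"
  unfolding P_mod_ops by (rule P_mod_memI) (auto intro: cong_add cong_P_mod_Suc)

lemma P_mod_smult_closed:
  "0 < p \<Longrightarrow> c \<in> carrier (padic_int p) \<Longrightarrow> x \<in> carrier (P_mod p \<alpha>) \<Longrightarrow>
    c \<odot>\<^bsub>P_mod p \<alpha>\<^esub> x \<in> carrier (P_mod p \<alpha>)"
  unfolding P_mod_ops by (rule P_mod_memI) (auto intro: cong_mult cong_P_mod_Suc cong_padic_int_Suc)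

lemma P_mod_neg_closed:
  "0 < p \<Longrightarrow> x \<in> carrier (P_mod p \<alpha>) \<Longrightarrow>
    (\<lambda>\<sigma>\<in>diamond \<alpha>. \<lambda>n. (- x \<sigma> n) mod int p ^ n) \<in> carrier (P_mod p \<alpha>)"
  by (rule P_mod_memI) (auto intro: cong_P_mod_Suc simp: cong_minus_minus_iff)

lemma P_mod_zero_closed: "0 < p \<Longrightarrow> \<zero>\<^bsub>P_mod p \<alpha>\<^esub> \<in> carrier (P_mod p \<alpha>)"
  by (auto simp: P_mod_ops P_mod_carrier padic_int_carrier)

lemma comm_group_P_add:
  assumes "0 < p"
  shows "comm_group (P_add p \<alpha>)"
proof (rule comm_groupI)
  note P_mod_add_closed [OF assms, simp] P_mod_zero_closed [OF assms, simp]
  fix x y z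
  assume *: "x \<in> carrier (P_add p \<alpha>)" "y \<in> carrier (P_add p \<alpha>)" "z \<in> carrier (P_add p \<alpha>)"
  then show "x \<otimes>\<^bsub>P_add p \<alpha>\<^esub> y \<in> carrier (P_add p \<alpha>)" by simp
  show "x \<otimes>\<^bsub>P_add p \<alpha>\<^esub> y \<otimes>\<^bsub>P_add p \<alpha>\<^esub> z = x \<otimes>\<^bsub>P_add p \<alpha>\<^esub> (y \<otimes>\<^bsub>P_add p \<alpha>\<^esub> z)"
    by (simp add: P_mod_ops mod_simps add.assoc cong: restrict_cong)
  show "x \<otimes>\<^bsub>P_add p \<alpha>\<^esub> y = y \<otimes>\<^bsub>P_add p \<alpha>\<^esub> x"
    by (simp add: P_mod_ops add.commute)
  show "\<one>\<^bsub>P_add p \<alpha>\<^esub> \<otimes>\<^bsub>P_add p \<alpha>\<^esub> x = x"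
  proof (rule P_mod_eqI [of _ p \<alpha>])
    fix \<sigma> n assume "\<sigma> \<in> diamond \<alpha>"
    then show "[(\<one>\<^bsub>P_add p \<alpha>\<^esub> \<otimes>\<^bsub>P_add p \<alpha>\<^esub> x) \<sigma> n = x \<sigma> n] (mod int p ^ n)"
      by (simp add: P_mod_ops cong_def)
  qed (use * in simp_all)
  show "\<exists>y\<in>carrier (P_add p \<alpha>). y \<otimes>\<^bsub>P_add p \<alpha>\<^esub> x = \<one>\<^bsub>P_add p \<alpha>\<^esub>"
    using P_mod_neg_closed [OF assms, of x \<alpha>] *
    by (intro bexI) (auto simp: P_mod_ops mod_simps cong: restrict_cong)
qed (use P_mod_zero_closed [OF assms] in simp)

lemma inv_P_add:
  assumes "0 < p" "x \<in> carrier (P_mod p \<alpha>)"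
  shows "inv\<^bsub>P_add p \<alpha>\<^esub> x = (\<lambda>\<sigma>\<in>diamond \<alpha>. \<lambda>n. (- x \<sigma> n) mod int p ^ n)"
proof -
  interpret P: comm_group "P_add p \<alpha>" using assms(1) by (rule comm_group_P_add)
  show ?thesis
    using P_mod_neg_closed [OF assms] assms(2)
    by (intro P.inv_equality) (auto simp: P_mod_ops mod_simps cong: restrict_cong)
qed

lemma nat_pow_P_add:
  "x [^]\<^bsub>P_add p \<alpha>\<^esub> (k::nat) = (\<lambda>\<sigma>\<in>diamond \<alpha>. \<lambda>n. (int k * x \<sigma> n) mod int p ^ n)"
proof (induction k)
  case 0
  then show ?case by (simp add: P_mod_ops)
next
  case (Suc k)
  show ?case
    unfolding nat_pow_Suc Suc by (auto simp: P_mod_ops fun_eq_iff mod_simps algebra_simps)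
qed

text \<open>The solution is \<open>x\<^sub>i = \<Sum>\<^sub>k p\<^sup>k a\<^sub>i\<^sub>+\<^sub>k\<close>; modulo \<open>p\<^sup>n\<close> only the terms with \<open>k < n\<close> matter.\<close>

lemma shift_solvable_P_add:
  assumes "0 < p"
  shows "shift_solvable p (P_add p \<alpha>)"
  unfolding shift_solvable_def
proof (intro allI impI)
  fix a :: "nat \<Rightarrow> 'a list \<Rightarrow> nat \<Rightarrow> int" assume "\<forall>i. a i \<in> carrier (P_add p \<alpha>)"
  then have a: "a i \<in> carrier (P_mod p \<alpha>)" for i by simp
  define x where "x i = (\<lambda>\<sigma>\<in>diamond \<alpha>. \<lambda>n. (\<Sum>k<n. int p ^ k * a (i + k) \<sigma> n) mod int p ^ n)" for i
  have "[(\<Sum>k<Suc n. int p ^ k * a (i + k) \<sigma> (Suc n)) = (\<Sum>k<n. int p ^ k * a (i + k) \<sigma> n)]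
      (mod int p ^ n)" if "\<sigma> \<in> diamond \<alpha>" for i \<sigma> n
  proof -
    have "[(\<Sum>k<n. int p ^ k * a (i + k) \<sigma> (Suc n)) + int p ^ n * a (i + n) \<sigma> (Suc n) =
        (\<Sum>k<n. int p ^ k * a (i + k) \<sigma> n) + 0] (mod int p ^ n)"
      using a that by (intro cong_add cong_sum cong_mult cong_refl cong_P_mod_Suc) (auto simp: cong_0_iff)
    then show ?thesis by simp
  qed
  then have x: "x i \<in> carrier (P_mod p \<alpha>)" for i
    unfolding x_def using assms by (intro P_mod_memI)
  have x_eq: "x i = a i \<otimes>\<^bsub>P_add p \<alpha>\<^esub> x (Suc i) [^]\<^bsub>P_add p \<alpha>\<^esub> p" for i
  proof (rule P_mod_eqI [of _ p \<alpha>])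
    interpret P: comm_group "P_add p \<alpha>" using assms by (rule comm_group_P_add)
    show "a i \<otimes>\<^bsub>P_add p \<alpha>\<^esub> x (Suc i) [^]\<^bsub>P_add p \<alpha>\<^esub> p \<in> carrier (P_mod p \<alpha>)"
      using a x P.m_closed P.nat_pow_closed by simp
    fix \<sigma> n assume \<sigma>: "\<sigma> \<in> diamond \<alpha>"
    \<comment> \<open>The sum over k < n + 1 is split at its last term on the left and at its first
      term on the right. The last term vanishes modulo p^n.\<close>
    have eq: "(\<Sum>k<n. int p ^ k * a (i + k) \<sigma> n) + int p ^ n * a (i + n) \<sigma> n =
        a i \<sigma> n + int p * (\<Sum>k<n. int p ^ k * a (Suc i + k) \<sigma> n)"
      by (subst sum.lessThan_Suc [symmetric], subst sum.lessThan_Suc_shift)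
        (simp add: sum_distrib_left mult.assoc)
    have "(\<Sum>k<n. int p ^ k * a (i + k) \<sigma> n) mod int p ^ n =
        (a i \<sigma> n + int p * (\<Sum>k<n. int p ^ k * a (Suc i + k) \<sigma> n)) mod int p ^ n"
      unfolding eq [symmetric] by simp
    then show "[x i \<sigma> n = (a i \<otimes>\<^bsub>P_add p \<alpha>\<^esub> x (Suc i) [^]\<^bsub>P_add p \<alpha>\<^esub> p) \<sigma> n] (mod int p ^ n)"
      using \<sigma> by (simp add: cong_def P_mod_ops(2) nat_pow_P_add x_def mod_simps)
  qed (rule x)
  have "x i \<in> carrier (P_add p \<alpha>)" for i
    using x by simp
  then show "\<exists>x. \<forall>i. x i \<in> carrier (P_add p \<alpha>) \<and>
      x i = a i \<otimes>\<^bsub>P_add p \<alpha>\<^esub> x (Suc i) [^]\<^bsub>P_add p \<alpha>\<^esub> p"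
    by (intro exI [of _ x] allI conjI x_eq)
qed

section \<open>Basis vectors, relators and the submodule they generate\<close>

lemma basis_elem_apply:
  "\<tau> \<in> diamond \<alpha> \<Longrightarrow> basis_elem p \<alpha> \<sigma> \<tau> = (\<lambda>n. if \<tau> = \<sigma> then 1 mod int p ^ n else 0)"
  by (simp add: basis_elem_def padic_int_ops)

lemma basis_elem_closed: "0 < p \<Longrightarrow> basis_elem p \<alpha> \<sigma> \<in> carrier (P_mod p \<alpha>)"
  by (auto simp: P_mod_carrier basis_elem_def padic_int_ops padic_int_carrier mod_mod_cancel
      le_imp_power_dvd)

text \<open>Since \<^term>\<open>[]\<close> is not in \<^term>\<open>diamond \<alpha>\<close>, \<^term>\<open>basis_elem p \<alpha> []\<close> is zero and the two cases
  of the definition of \<^const>\<open>relator\<close> merge into one.\<close>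

lemma relator_eq:
  assumes "0 < p" "\<sigma> \<in> diamond \<alpha>"
  shows "relator p \<alpha> \<sigma> = basis_elem p \<alpha> \<sigma> [^]\<^bsub>P_add p \<alpha>\<^esub> p
    \<otimes>\<^bsub>P_add p \<alpha>\<^esub> inv\<^bsub>P_add p \<alpha>\<^esub> basis_elem p \<alpha> (tl \<sigma>)"
proof -
  interpret P: comm_group "P_add p \<alpha>" using assms(1) by (rule comm_group_P_add)
  note basis_elem_closed [OF assms(1), of \<alpha>, simp]
  have "basis_elem p \<alpha> [] = \<one>\<^bsub>P_add p \<alpha>\<^esub>"
    by (auto simp: basis_elem_def P_mod_ops padic_int_ops diamond_def)
  moreover have "length \<sigma> = 1 \<Longrightarrow> tl \<sigma> = []"
    by (cases \<sigma>) auto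
  ultimately show ?thesis
    using P.r_one [of "basis_elem p \<alpha> \<sigma> [^]\<^bsub>P_add p \<alpha>\<^esub> p"] P.inv_one P.nat_pow_closed
    by (auto simp: relator_def add_pow_def a_minus_def a_inv_def)
qed

text \<open>Written as an integer combination with coefficients p and -1, the shape that
  \<open>relator_coeff_lincomb\<close> expects.\<close>

lemma relator_cong:
  assumes "0 < p" "\<sigma> \<in> diamond \<alpha>" "\<tau> \<in> diamond \<alpha>"
  shows "[relator p \<alpha> \<sigma> \<tau> n =
    int p * basis_elem p \<alpha> \<sigma> \<tau> n + (- 1) * basis_elem p \<alpha> (tl \<sigma>) \<tau> n] (mod int p ^ n)"
  using assms by (simp add: relator_eq P_mod_ops(2) nat_pow_P_add inv_P_add basis_elem_closed cong_def mod_simps)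

lemma relator_closed:
  assumes "0 < p" "\<sigma> \<in> diamond \<alpha>"
  shows "relator p \<alpha> \<sigma> \<in> carrier (P_mod p \<alpha>)"
proof -
  interpret P: comm_group "P_add p \<alpha>" using assms(1) by (rule comm_group_P_add)
  show ?thesis
    using P.m_closed P.nat_pow_closed P.inv_closed basis_elem_closed [OF assms(1), of \<alpha>]
    unfolding relator_eq [OF assms] by simp
qed

text \<open>Makes the family of submodules intersected in \<open>R_sub\<close> nonempty, so that the
  intersection is a subgroup.\<close>

lemma submodule_carrier_P_mod:
  assumes "0 < p"
  shows "submodule (carrier (P_mod p \<alpha>)) (padic_int p) (P_mod p \<alpha>)"
proof -
  interpret P: comm_group "P_add p \<alpha>" using assms by (rule comm_group_P_add)
  show ?thesis
    using P.subgroup_self P_mod_smult_closed [OF assms, of _ _ \<alpha>]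
    by (simp add: submodule_def submodule_axioms_def)
qed

lemma subgroup_R_sub:
  assumes "0 < p"
  shows "subgroup (R_sub p \<alpha>) (P_add p \<alpha>)"
proof -
  interpret P: comm_group "P_add p \<alpha>" using assms by (rule comm_group_P_add)
  show ?thesis
    unfolding R_sub_def hull_def
    using submodule_carrier_P_mod [OF assms, of \<alpha>] relator_closed [OF assms, of _ \<alpha>]
    by (intro P.subgroups_Inter) (auto simp: submodule_def)
qed

lemma relator_in_R_sub: "\<sigma> \<in> diamond \<alpha> \<Longrightarrow> relator p \<alpha> \<sigma> \<in> R_sub p \<alpha>"
  unfolding R_sub_def by (intro hull_inc imageI)

section \<open>Heights in \<open>D\<^sub>\<alpha>\<close>\<close>

definition supp :: "'o::wellorder \<Rightarrow> ('o list \<Rightarrow> nat \<Rightarrow> int) \<Rightarrow> 'o list set" where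
  "supp \<alpha> x = {\<sigma> \<in> diamond \<alpha>. x \<sigma> \<noteq> (\<lambda>n. 0)}"

text \<open>
  A finitely supported \<open>x\<close> is \<open>\<Sum>\<^sub>\<sigma> b\<^sub>\<sigma> r\<^sub>\<sigma>\<close> for unique \<open>b\<^sub>\<sigma> \<in> \<rat>\<^sub>p\<close>, namely
  \<open>b\<^sub>\<sigma> = \<Sum> x\<^sub>\<rho> / p\<^bsup>|\<rho>| - |\<sigma>| + 1\<^esup>\<close> over the \<open>\<rho>\<close> with suffix \<open>\<sigma>\<close>. The real number below
  represents \<open>b\<^sub>\<sigma>\<close> in \<open>\<rat>\<^sub>p / \<int>\<^sub>p \<subseteq> \<real> / \<int>\<close>.
\<close>

definition relator_coeff :: "nat \<Rightarrow> 'o::wellorder \<Rightarrow> ('o list \<Rightarrow> nat \<Rightarrow> int) \<Rightarrow> 'o list \<Rightarrow> real" where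
  "relator_coeff p \<alpha> x \<sigma> = (\<Sum>\<rho> | \<rho> \<in> supp \<alpha> x \<and> suffix \<sigma> \<rho>.
     real_of_int (x \<rho> (Suc (length \<rho> - length \<sigma>))) / real p ^ Suc (length \<rho> - length \<sigma>))"

text \<open>Indices outside the support contribute zero. Thus the coefficients of several vectors
  can be summed over one common finite set.\<close>

lemma relator_coeff_superset:
  assumes "finite F" "supp \<alpha> x \<subseteq> F" "F \<subseteq> diamond \<alpha>"
  shows "relator_coeff p \<alpha> x \<sigma> = (\<Sum>\<rho> | \<rho> \<in> F \<and> suffix \<sigma> \<rho>.
     real_of_int (x \<rho> (Suc (length \<rho> - length \<sigma>))) / real p ^ Suc (length \<rho> - length \<sigma>))"
  unfolding relator_coeff_def
  by (rule sum.mono_neutral_left) (use assms in \<open>auto simp: supp_def\<close>)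

text \<open>The class of a / p^n modulo the integers depends only on a modulo p^n. This is why a
  single residue of each p-adic entry suffices in \<open>relator_coeff\<close>.\<close>

lemma cong_imp_diff_in_Ints:
  assumes "0 < p" "[a = b] (mod int p ^ n)"
  shows "real_of_int a / real p ^ n - real_of_int b / real p ^ n \<in> \<int>"
proof -
  obtain k where "a - b = int p ^ n * k"
    using assms(2) by (auto simp: cong_iff_dvd_diff)
  then have "real_of_int a - real_of_int b = real p ^ n * real_of_int k"
    by (metis of_int_diff of_int_mult of_int_of_nat_eq of_int_power)
  then have "real_of_int a / real p ^ n - real_of_int b / real p ^ n = real_of_int k"
    using assms(1) by (simp add: diff_divide_distrib [symmetric])
  then show ?thesis by simp
qed

text \<open>The bound on \<open>n\<close> allows an approximation of a \<open>p\<close>-adic scalar by an integer \<open>u\<close>.\<close>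

lemma relator_coeff_lincomb:
  assumes "0 < p" "finite F" "supp \<alpha> x \<subseteq> F" "supp \<alpha> y \<subseteq> F" "supp \<alpha> z \<subseteq> F" "F \<subseteq> diamond \<alpha>"
    and "\<And>\<rho> n. \<rho> \<in> F \<Longrightarrow> n \<le> Suc (length \<rho>) \<Longrightarrow> [z \<rho> n = u * x \<rho> n + v * y \<rho> n] (mod int p ^ n)"
  shows "relator_coeff p \<alpha> z \<sigma> - (of_int u * relator_coeff p \<alpha> x \<sigma> + of_int v * relator_coeff p \<alpha> y \<sigma>) \<in> \<int>"
proof -
  let ?n = "\<lambda>\<rho>. Suc (length \<rho> - length \<sigma>)"
  note superset = relator_coeff_superset [OF assms(2) _ assms(6), of _ p \<sigma>]
  have "relator_coeff p \<alpha> z \<sigma> - (of_int u * relator_coeff p \<alpha> x \<sigma> + of_int v * relator_coeff p \<alpha> y \<sigma>) =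
      (\<Sum>\<rho> | \<rho> \<in> F \<and> suffix \<sigma> \<rho>. real_of_int (z \<rho> (?n \<rho>)) / real p ^ ?n \<rho>
        - real_of_int (u * x \<rho> (?n \<rho>) + v * y \<rho> (?n \<rho>)) / real p ^ ?n \<rho>)"
    by (simp add: superset assms sum_subtractf sum.distrib sum_distrib_left add_divide_distrib)
  also have "\<dots> \<in> \<int>"
    using assms(1) by (intro Ints_sum cong_imp_diff_in_Ints assms(7)) auto
  finally show ?thesis .
qed

lemma relator_coeff_lincomb_Ints:
  assumes "0 < p" "finite F" "supp \<alpha> x \<subseteq> F" "supp \<alpha> y \<subseteq> F" "supp \<alpha> z \<subseteq> F" "F \<subseteq> diamond \<alpha>"
    and "\<And>\<rho> n. \<rho> \<in> F \<Longrightarrow> n \<le> Suc (length \<rho>) \<Longrightarrow> [z \<rho> n = u * x \<rho> n + v * y \<rho> n] (mod int p ^ n)"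
    and "of_int u * relator_coeff p \<alpha> x \<sigma> \<in> \<int>" "of_int v * relator_coeff p \<alpha> y \<sigma> \<in> \<int>"
  shows "relator_coeff p \<alpha> z \<sigma> \<in> \<int>"
  using Ints_add [OF relator_coeff_lincomb [OF assms(1-7), where \<sigma> = \<sigma>] Ints_add [OF assms(8,9)]]
  by simp

lemma relator_coeff_basis_elem:
  assumes "1 < p" "\<tau> \<in> diamond \<alpha>"
  shows "relator_coeff p \<alpha> (basis_elem p \<alpha> \<tau>) \<sigma> =
    (if suffix \<sigma> \<tau> then 1 / real p ^ Suc (length \<tau> - length \<sigma>) else 0)"
proof -
  have "supp \<alpha> (basis_elem p \<alpha> \<tau>) \<subseteq> {\<tau>}"
    by (auto simp: supp_def basis_elem_apply)
  then have "relator_coeff p \<alpha> (basis_elem p \<alpha> \<tau>) \<sigma> = (\<Sum>\<rho> | \<rho> \<in> {\<tau>} \<and> suffix \<sigma> \<rho>.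
     real_of_int (basis_elem p \<alpha> \<tau> \<rho> (Suc (length \<rho> - length \<sigma>))) / real p ^ Suc (length \<rho> - length \<sigma>))"
    using assms by (intro relator_coeff_superset) auto
  moreover have "{\<rho>. \<rho> \<in> {\<tau>} \<and> suffix \<sigma> \<rho>} = (if suffix \<sigma> \<tau> then {\<tau>} else {})" by auto
  \<comment> \<open>The coefficient reads residues at positive levels only; at level 0 the unit
    would reduce to 0.\<close>
  moreover have "1 mod int p ^ Suc n = 1" for n
    using assms(1) power_gt1 [of "int p" n] by (intro mod_pos_pos_trivial) auto
  ultimately show ?thesis
    using assms(2) by (simp add: basis_elem_apply del: power_Suc)
qed

lemma diamond_suffix: "\<rho> \<in> diamond \<alpha> \<Longrightarrow> suffix \<sigma> \<rho> \<Longrightarrow> \<sigma> \<noteq> [] \<Longrightarrow> \<sigma> \<in> diamond \<alpha>"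
  by (auto simp: diamond_def suffix_def sorted_wrt_append)

lemma Cons_mem_diamond: "\<sigma> \<in> diamond \<alpha> \<Longrightarrow> \<gamma> # \<sigma> \<in> diamond \<alpha> \<longleftrightarrow> \<gamma> < hd \<sigma>"
  by (cases \<sigma>) (auto simp: diamond_def)

lemma supp_relator:
  assumes "0 < p" "\<tau> \<in> diamond \<alpha>"
  shows "supp \<alpha> (relator p \<alpha> \<tau>) \<subseteq> {\<tau>, tl \<tau>}"
proof -
  have "relator p \<alpha> \<tau> \<rho> n = 0" if "\<rho> \<in> diamond \<alpha>" "\<rho> \<notin> {\<tau>, tl \<tau>}" for \<rho> n
  proof -
    have "[relator p \<alpha> \<tau> \<rho> n = 0] (mod int p ^ n)"
      using relator_cong [OF assms that(1), of n] that by (simp add: basis_elem_apply)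
    then show ?thesis
      using P_mod_memD [OF relator_closed [OF assms] that(1)] by (simp add: cong_def)
  qed
  then show ?thesis by (auto simp: supp_def)
qed

text \<open>The exact coefficient of a relator at \<sigma> is 1 for \<sigma> = \<tau> and 0
  otherwise: at proper suffixes of \<tau> the contributions of the two basis vectors cancel.\<close>

lemma relator_coeff_relator:
  assumes "1 < p" "\<tau> \<in> diamond \<alpha>" "\<sigma> \<in> diamond \<alpha>"
  shows "relator_coeff p \<alpha> (relator p \<alpha> \<tau>) \<sigma> \<in> \<int>"
proof -
  let ?e = "basis_elem p \<alpha>"
  \<comment> \<open>The intersection removes the tail when it is empty.\<close>
  let ?F = "{\<tau>, tl \<tau>} \<inter> diamond \<alpha>"
  have p: "0 < p" using assms(1) by simp
  have supp_e: "supp \<alpha> (?e \<rho>) \<subseteq> {\<rho>} \<inter> diamond \<alpha>" for \<rho>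
    by (auto simp: supp_def basis_elem_apply)
  have "relator_coeff p \<alpha> (relator p \<alpha> \<tau>) \<sigma> -
      (of_int (int p) * relator_coeff p \<alpha> (?e \<tau>) \<sigma> + of_int (- 1) * relator_coeff p \<alpha> (?e (tl \<tau>)) \<sigma>) \<in> \<int>"
  proof (rule relator_coeff_lincomb [where F = ?F])
    show "supp \<alpha> (relator p \<alpha> \<tau>) \<subseteq> ?F"
      using supp_relator [OF p assms(2)] by (auto simp: supp_def)
  qed (use p assms supp_e relator_cong [OF p assms(2)] in auto)
  moreover have "real p * relator_coeff p \<alpha> (?e \<tau>) \<sigma> - relator_coeff p \<alpha> (?e (tl \<tau>)) \<sigma> \<in> \<int>"
  proof (cases "tl \<tau> = []")
    case True
    then have "relator_coeff p \<alpha> (?e (tl \<tau>)) \<sigma> = 0"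
      by (auto simp: relator_coeff_def supp_def basis_elem_apply diamond_def)
    moreover have "suffix \<sigma> \<tau> \<Longrightarrow> \<sigma> = \<tau>"
      using True assms by (cases \<tau>) (auto simp: diamond_def suffix_Cons)
    ultimately show ?thesis
      using assms by (auto simp: relator_coeff_basis_elem)
  next
    case False
    then have tl: "tl \<tau> \<in> diamond \<alpha>"
      using diamond_suffix [OF assms(2)] by simp
    obtain c where \<tau>: "\<tau> = c # tl \<tau>"
      using assms(2) by (cases \<tau>) (auto simp: diamond_def)
    \<comment> \<open>The denominator for \<tau> has one more factor p than the one for its tail;
      the factor p in the relator cancels it.\<close>
    have eq: "length \<tau> - length \<sigma> = Suc (length (tl \<tau>) - length \<sigma>)" if "suffix \<sigma> (tl \<tau>)"
      using suffix_length_le [OF that] \<tau> by (metis Suc_diff_le length_Cons)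
    have "suffix \<sigma> \<tau> \<longleftrightarrow> \<sigma> = \<tau> \<or> suffix \<sigma> (tl \<tau>)"
      using \<tau> by (metis suffix_Cons)
    moreover have "\<not> suffix \<tau> (tl \<tau>)"
      using \<tau> by (metis suffix_length_le length_Cons not_less_eq_eq order_refl)
    ultimately show ?thesis
      using assms tl eq by (auto simp: relator_coeff_basis_elem)
  qed
  ultimately show ?thesis
    using Ints_add by fastforce
qed

text \<open>Provides an upper bound for \<open>R_sub\<close>: a submodule, described by integrality,
  that contains all relators.\<close>

lemma submodule_relator_coeff:
  assumes "1 < p"
  shows "submodule {x \<in> carrier (P_mod p \<alpha>). finite (supp \<alpha> x) \<and>
    (\<forall>\<sigma>\<in>diamond \<alpha>. relator_coeff p \<alpha> x \<sigma> \<in> \<int>)} (padic_int p) (P_mod p \<alpha>)"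
    (is "submodule ?K _ _")
proof -
  have p: "0 < p" using assms by simp
  interpret P: comm_group "P_add p \<alpha>" using p by (rule comm_group_P_add)
  have D: "supp \<alpha> x \<subseteq> diamond \<alpha>" for x by (auto simp: supp_def)
  have "subgroup ?K (P_add p \<alpha>)"
  proof (rule P.subgroupI)
    have "supp \<alpha> \<zero>\<^bsub>P_mod p \<alpha>\<^esub> = {}" by (auto simp: supp_def P_mod_ops)
    then have "\<zero>\<^bsub>P_mod p \<alpha>\<^esub> \<in> ?K"
      using P_mod_zero_closed [OF p] by (simp add: relator_coeff_def)
    then show "?K \<noteq> {}" by blast
  next
    fix x assume x: "x \<in> ?K"
    let ?y = "inv\<^bsub>P_add p \<alpha>\<^esub> x"
    have y: "supp \<alpha> ?y \<subseteq> supp \<alpha> x"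
      using x by (auto simp: supp_def inv_P_add p)
    have "relator_coeff p \<alpha> ?y \<sigma> \<in> \<int>" if "\<sigma> \<in> diamond \<alpha>" for \<sigma>
    proof (rule relator_coeff_lincomb_Ints [where F = "supp \<alpha> x" and x = x and y = x and u = "-1" and v = 0])
      show "[?y \<rho> n = - 1 * x \<rho> n + 0 * x \<rho> n] (mod int p ^ n)" if "\<rho> \<in> supp \<alpha> x" for \<rho> n
        using x that p by (simp add: inv_P_add cong_def supp_def)
    qed (use p x y D that in auto)
    then show "?y \<in> ?K"
      using x y P.inv_closed by (auto intro: finite_subset)
  next
    fix x y assume xy: "x \<in> ?K" "y \<in> ?K"
    let ?z = "x \<otimes>\<^bsub>P_add p \<alpha>\<^esub> y"
    have z: "supp \<alpha> ?z \<subseteq> supp \<alpha> x \<union> supp \<alpha> y"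
      by (auto simp: supp_def P_mod_ops)
    have "relator_coeff p \<alpha> ?z \<sigma> \<in> \<int>" if "\<sigma> \<in> diamond \<alpha>" for \<sigma>
    proof (rule relator_coeff_lincomb_Ints [where F = "supp \<alpha> x \<union> supp \<alpha> y" and x = x and y = y and u = 1 and v = 1])
      show "[?z \<rho> n = 1 * x \<rho> n + 1 * y \<rho> n] (mod int p ^ n)" if "\<rho> \<in> supp \<alpha> x \<union> supp \<alpha> y" for \<rho> n
        using that D by (auto simp: P_mod_ops cong_def supp_def)
    qed (use p xy z D that in auto)
    then show "?z \<in> ?K"
      using xy z P.m_closed by (auto intro: finite_subset)
  qed auto
  moreover have "c \<odot>\<^bsub>P_mod p \<alpha>\<^esub> x \<in> ?K" if c: "c \<in> carrier (padic_int p)" and x: "x \<in> ?K" for c x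
  proof -
    let ?z = "c \<odot>\<^bsub>P_mod p \<alpha>\<^esub> x"
    have z: "supp \<alpha> ?z \<subseteq> supp \<alpha> x" by (auto simp: supp_def P_mod_ops)
    \<comment> \<open>The coefficients of x read no level above N + 1, so the p-adic scalar c can be
      replaced by the integer \<open>c (Suc N)\<close>.\<close>
    obtain N where N: "\<forall>\<rho>\<in>supp \<alpha> x. length \<rho> \<le> N"
      using x finite_nat_set_iff_bounded_le [of "length ` supp \<alpha> x"] by auto
    have "relator_coeff p \<alpha> ?z \<sigma> \<in> \<int>" if "\<sigma> \<in> diamond \<alpha>" for \<sigma>
    proof (rule relator_coeff_lincomb_Ints [where F = "supp \<alpha> x" and x = x and y = x and u = "c (Suc N)" and v = 0])
      fix \<rho> n assume \<rho>: "\<rho> \<in> supp \<alpha> x" and n: "n \<le> Suc (length \<rho>)"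
      then have "c (Suc N) mod int p ^ n = c n"
        using N by (intro padic_int_mod [OF c]) (meson Suc_le_mono order_trans)
      then have "[c n * x \<rho> n = c (Suc N) * x \<rho> n] (mod int p ^ n)"
        by (metis cong_def mod_mult_left_eq)
      then show "[?z \<rho> n = c (Suc N) * x \<rho> n + 0 * x \<rho> n] (mod int p ^ n)"
        using \<rho> by (simp add: P_mod_ops supp_def cong_def)
    qed (use p x z D that in auto)
    then show ?thesis
      using x z P_mod_smult_closed [OF p c, of x \<alpha>] by (auto intro: finite_subset)
  qed
  ultimately show ?thesis
    unfolding submodule_def submodule_axioms_def by blast
qed

lemma R_sub_relator_coeff:
  assumes "1 < p" "x \<in> R_sub p \<alpha>"
  shows "x \<in> carrier (P_mod p \<alpha>)" "finite (supp \<alpha> x)"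
    "\<sigma> \<in> diamond \<alpha> \<Longrightarrow> relator_coeff p \<alpha> x \<sigma> \<in> \<int>"
proof -
  have "relator p \<alpha> ` diamond \<alpha> \<subseteq> {x \<in> carrier (P_mod p \<alpha>). finite (supp \<alpha> x) \<and>
      (\<forall>\<sigma>\<in>diamond \<alpha>. relator_coeff p \<alpha> x \<sigma> \<in> \<int>)}"
    using assms(1) relator_closed [of p _ \<alpha>] supp_relator [of p _ \<alpha>] relator_coeff_relator [OF assms(1), of _ \<alpha>]
    by (auto intro: finite_subset)
  then have "R_sub p \<alpha> \<subseteq> {x \<in> carrier (P_mod p \<alpha>). finite (supp \<alpha> x) \<and>
      (\<forall>\<sigma>\<in>diamond \<alpha>. relator_coeff p \<alpha> x \<sigma> \<in> \<int>)}"
    unfolding R_sub_def by (rule hull_minimal) (rule submodule_relator_coeff [OF assms(1)])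
  then show "x \<in> carrier (P_mod p \<alpha>)" "finite (supp \<alpha> x)"
    "\<sigma> \<in> diamond \<alpha> \<Longrightarrow> relator_coeff p \<alpha> x \<sigma> \<in> \<int>"
    using assms(2) by auto
qed

text \<open>In terms of the exact coefficients, \<open>p b\<^sub>\<sigma> = x\<^sub>\<sigma> + \<Sum>\<^sub>\<gamma> b\<^sub>\<gamma>\<^sub>\<sigma>\<close>.\<close>

lemma relator_coeff_times_p:
  fixes \<alpha> :: "'o::wellorder"
  assumes "0 < p" "x \<in> carrier (P_mod p \<alpha>)" "finite (supp \<alpha> x)"
    and "\<sigma> \<in> diamond \<alpha>" "\<And>\<gamma>. \<gamma> # \<sigma> \<in> diamond \<alpha> \<Longrightarrow> relator_coeff p \<alpha> x (\<gamma> # \<sigma>) \<in> \<int>"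
  shows "real p * relator_coeff p \<alpha> x \<sigma> \<in> \<int>"
proof -
  define f where "f \<rho> = real_of_int (x \<rho> (Suc (length \<rho> - length \<sigma>))) / real p ^ (length \<rho> - length \<sigma>)" for \<rho>
  define A where "A = {\<rho> \<in> supp \<alpha> x. suffix \<sigma> \<rho>}"
  \<comment> \<open>For \<rho> \<noteq> \<sigma> in A this is the entry just before the suffix
    \<sigma>. Grouping by it produces the sums over the suffixes
    \<open>\<gamma> # \<sigma>\<close>.\<close>
  define g where "g \<rho> = last (take (length \<rho> - length \<sigma>) \<rho>)" for \<rho> :: "'o list"
  have fin: "finite A" using assms(3) by (simp add: A_def)
  have "real p * relator_coeff p \<alpha> x \<sigma> = sum f A"
    using assms(1) by (simp add: relator_coeff_def A_def f_def sum_distrib_left)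
  \<comment> \<open>The term at \<rho> = \<sigma> has denominator p^0, so it is an integer.\<close>
  also have "\<dots> = sum f (A \<inter> {\<sigma>}) + sum f (A - {\<sigma>})"
    using fin by (rule sum.Int_Diff)
  also have "\<dots> = sum f (A \<inter> {\<sigma>}) + (\<Sum>\<gamma>\<in>g ` (A - {\<sigma>}). sum f {\<rho> \<in> A - {\<sigma>}. g \<rho> = \<gamma>})"
    using fin by (simp add: sum.image_gen [where g = g])
  also have "\<dots> \<in> \<int>"
  proof (rule Ints_add)
    show "sum f (A \<inter> {\<sigma>}) \<in> \<int>"
      by (rule Ints_sum) (auto simp: f_def)
    show "(\<Sum>\<gamma>\<in>g ` (A - {\<sigma>}). sum f {\<rho> \<in> A - {\<sigma>}. g \<rho> = \<gamma>}) \<in> \<int>"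
    proof (rule Ints_sum)
      fix \<gamma> assume "\<gamma> \<in> g ` (A - {\<sigma>})"
      have A_suffix: "\<rho> \<in> A - {\<sigma>} \<and> g \<rho> = \<gamma> \<longleftrightarrow> \<rho> \<in> supp \<alpha> x \<and> suffix (\<gamma> # \<sigma>) \<rho>" for \<rho>
      proof
        assume *: "\<rho> \<in> A - {\<sigma>} \<and> g \<rho> = \<gamma>"
        then obtain zs where "\<rho> = zs @ \<sigma>" by (auto simp: A_def suffix_def)
        with * show "\<rho> \<in> supp \<alpha> x \<and> suffix (\<gamma> # \<sigma>) \<rho>"
          by (cases zs rule: rev_cases) (auto simp: A_def g_def suffix_def)
      next
        assume "\<rho> \<in> supp \<alpha> x \<and> suffix (\<gamma> # \<sigma>) \<rho>"
        then show "\<rho> \<in> A - {\<sigma>} \<and> g \<rho> = \<gamma>"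
          by (auto simp: A_def g_def suffix_def)
      qed
      from \<open>\<gamma> \<in> g ` (A - {\<sigma>})\<close> obtain \<rho> where "\<rho> \<in> supp \<alpha> x" "suffix (\<gamma> # \<sigma>) \<rho>"
        using A_suffix by blast
      then have "\<gamma> # \<sigma> \<in> diamond \<alpha>"
        using diamond_suffix [of \<rho> \<alpha> "\<gamma> # \<sigma>"] by (simp add: supp_def)
      then have int: "relator_coeff p \<alpha> x (\<gamma> # \<sigma>) \<in> \<int>" by (rule assms(5))
      \<comment> \<open>Both sums have the same denominators, but f reads each entry one level
        higher. Coherence of p-adic integers makes the difference integral.\<close>
      have "sum f {\<rho> \<in> A - {\<sigma>}. g \<rho> = \<gamma>} - relator_coeff p \<alpha> x (\<gamma> # \<sigma>) =
        (\<Sum>\<rho> | \<rho> \<in> supp \<alpha> x \<and> suffix (\<gamma> # \<sigma>) \<rho>.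
          real_of_int (x \<rho> (Suc (length \<rho> - length \<sigma>))) / real p ^ (length \<rho> - length \<sigma>) -
          real_of_int (x \<rho> (length \<rho> - length \<sigma>)) / real p ^ (length \<rho> - length \<sigma>))"
        unfolding A_suffix relator_coeff_def sum_subtractf f_def
        by (intro arg_cong2 [where f = "(-)"] refl sum.cong)
          (auto simp: suffix_def Suc_diff_Suc)
      also have "\<dots> \<in> \<int>"
        using assms(1,2) by (intro Ints_sum cong_imp_diff_in_Ints cong_P_mod_Suc) (auto simp: supp_def)
      finally show "sum f {\<rho> \<in> A - {\<sigma>}. g \<rho> = \<gamma>} \<in> \<int>"
        using Ints_add [OF _ int] by fastforce
    qed
  qed
  finally show ?thesis .
qed

lemma comm_group_D_grp: "0 < p \<Longrightarrow> comm_group (D_grp p \<alpha>)"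
  unfolding D_grp_def by (intro comm_group.abelian_FactGroup comm_group_P_add subgroup_R_sub)

text \<open>\<open>D\<^sub>\<alpha>\<close> modulo the image of \<open>P'\<^sub>\<alpha>\<close> is torsion free, so a finitely supported multiple of \<open>p\<close> in
  \<open>D\<^sub>\<alpha>\<close> is \<open>p\<close> times a finitely supported element. This is the successor step.\<close>

lemma p_pow_D_grp_relator_coeff:
  fixes \<alpha> :: "'o::{wellorder,no_top}"
  assumes "1 < p" "x \<in> carrier (P_mod p \<alpha>)" "finite (supp \<alpha> x)"
    and "R_sub p \<alpha> #>\<^bsub>P_add p \<alpha>\<^esub> x \<in> p_pow p (D_grp p \<alpha>) \<beta>" "\<sigma> \<in> diamond \<alpha>" "hd \<sigma> < \<beta>"
  shows "relator_coeff p \<alpha> x \<sigma> \<in> \<int>"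
  using assms(2-6)
proof (induction \<beta> arbitrary: x \<sigma> rule: ordinal_induct)
  case (zero \<beta>)
  then show ?case by simp
next
  case (limit \<beta>)
  \<comment> \<open>The induction hypothesis is used at \<open>osucc (hd \<sigma>)\<close>, which is
    still above \<open>hd \<sigma>\<close>.\<close>
  then have "osucc (hd \<sigma>) < \<beta>" by (simp add: is_limit_osucc_less)
  with limit.prems limit.hyps show ?case
    by (intro limit.IH [of "osucc (hd \<sigma>)"]) (auto simp: p_pow_limit)
next
  case (succ \<beta>)
  have p: "0 < p" using assms(1) by simp
  let ?P = "P_add p \<alpha>" and ?R = "R_sub p \<alpha>" and ?D = "D_grp p \<alpha>"
  interpret P: comm_group ?P using p by (rule comm_group_P_add)
  interpret D: comm_group ?D using p by (rule comm_group_D_grp)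
  interpret R: normal ?R ?P using subgroup_R_sub [OF p] by (rule P.subgroup_imp_normal)
  from succ.prems(3) obtain C where C: "C \<in> p_pow p ?D \<beta>" "?R #>\<^bsub>?P\<^esub> x = C [^]\<^bsub>?D\<^esub> p"
    unfolding p_pow_osucc by blast
  obtain y where y: "y \<in> carrier ?P" "C = ?R #>\<^bsub>?P\<^esub> y"
    using D.p_pow_closed [OF C(1)] unfolding D_grp_def by (rule carrier_FactGroupE)
  have "?R #>\<^bsub>?P\<^esub> x = ?R #>\<^bsub>?P\<^esub> (y [^]\<^bsub>?P\<^esub> p)"
    using C(2) y by (simp add: D_grp_def R.FactGroup_pow)
  then have "x \<in> ?R #>\<^bsub>?P\<^esub> (y [^]\<^bsub>?P\<^esub> p)"
    using P.rcos_self [OF _ R.subgroup_axioms] succ.prems(1) by fastforce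
  then obtain r where r: "r \<in> ?R" "x = r \<otimes>\<^bsub>?P\<^esub> y [^]\<^bsub>?P\<^esub> p"
    by (auto simp: r_coset_def)
  note rK = R_sub_relator_coeff [OF assms(1) r(1)]
  have x_cong: "[x \<rho> n = 1 * r \<rho> n + int p * y \<rho> n] (mod int p ^ n)" if "\<rho> \<in> diamond \<alpha>" for \<rho> n
    using that by (simp add: r(2) P_mod_ops(2) nat_pow_P_add cong_def mod_simps)
  \<comment> \<open>Here p times the entry of y is zero. Cancelling p costs one level, so the
    congruence is read at level n + 1.\<close>
  have "y \<rho> n = 0" if \<rho>: "\<rho> \<in> diamond \<alpha>" "\<rho> \<notin> supp \<alpha> x" "\<rho> \<notin> supp \<alpha> r" for \<rho> n
  proof -
    have "[0 = int p * y \<rho> (Suc n)] (mod int p ^ Suc n)"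
      using x_cong [OF \<rho>(1), of "Suc n"] \<rho> by (simp add: supp_def)
    then have "int p ^ n dvd y \<rho> (Suc n)"
      using p by (simp add: cong_0_iff cong_sym_eq [of 0])
    moreover have "y \<rho> \<in> carrier (padic_int p)"
      using y(1) \<rho>(1) by (intro P_mod_memD) auto
    ultimately show ?thesis
      by (metis dvd_eq_mod_eq_0 le_SucI order_refl padic_int_mod)
  qed
  then have supp_y: "supp \<alpha> y \<subseteq> supp \<alpha> x \<union> supp \<alpha> r"
    by (auto simp: supp_def)
  then have fin_y: "finite (supp \<alpha> y)"
    using succ.prems(2) rK(2) by (auto intro: finite_subset)
  \<comment> \<open>Prepending \<gamma> lowers the head from at most \<beta> to strictly below
    \<beta>, so the hypothesis applies to y. Integrality of p times its coefficient at \<sigma> is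
    then all that x = r + p y requires.\<close>
  have "relator_coeff p \<alpha> y (\<gamma> # \<sigma>) \<in> \<int>" if "\<gamma> # \<sigma> \<in> diamond \<alpha>" for \<gamma>
  proof (rule succ.IH)
    show "?R #>\<^bsub>?P\<^esub> y \<in> p_pow p ?D \<beta>" using C(1) y(2) by simp
    have "\<gamma> < hd \<sigma>" using that succ.prems(4) by (simp add: Cons_mem_diamond)
    then show "hd (\<gamma> # \<sigma>) < \<beta>" using succ.prems(5) by (simp add: less_osucc_iff)
  qed (use that fin_y y(1) in auto)
  then have py: "real p * relator_coeff p \<alpha> y \<sigma> \<in> \<int>"
    using p fin_y y(1) succ.prems(4) by (intro relator_coeff_times_p) auto
  show ?case
  proof (rule relator_coeff_lincomb_Ints [where F = "supp \<alpha> x \<union> supp \<alpha> r" and x = r and y = y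
        and u = 1 and v = "int p"])
    show "supp \<alpha> x \<union> supp \<alpha> r \<subseteq> diamond \<alpha>" by (auto simp: supp_def)
    show "[x \<rho> n = 1 * r \<rho> n + int p * y \<rho> n] (mod int p ^ n)" if "\<rho> \<in> supp \<alpha> x \<union> supp \<alpha> r" for \<rho> n
      using that by (intro x_cong) (auto simp: supp_def)
  qed (use p succ.prems rK supp_y py in auto)
qed

text \<open>For \<beta> < \<open>hd \<sigma>\<close> the relator of
  \<open>\<beta> # \<sigma>\<close> exhibits the class of the basis vector at \<sigma> as p times a
  class of height at least \<beta>.\<close>

lemma basis_elem_mem_p_pow:
  fixes \<alpha> :: "'o::{wellorder,no_top}"
  assumes "0 < p" "\<sigma> \<in> diamond \<alpha>" "\<beta> \<le> hd \<sigma>"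
  shows "R_sub p \<alpha> #>\<^bsub>P_add p \<alpha>\<^esub> basis_elem p \<alpha> \<sigma> \<in> p_pow p (D_grp p \<alpha>) \<beta>"
  using assms(2,3)
proof (induction \<beta> arbitrary: \<sigma> rule: ordinal_induct)
  case (zero \<beta>)
  then show ?case
    using basis_elem_closed [OF assms(1), of \<alpha> \<sigma>] by (simp add: p_pow_zero D_grp_def carrier_FactGroup)
next
  case (limit \<beta>)
  then show ?case by (auto simp: p_pow_limit)
next
  case (succ \<beta>)
  let ?P = "P_add p \<alpha>" and ?R = "R_sub p \<alpha>" and ?e = "basis_elem p \<alpha>"
  interpret P: comm_group ?P using assms(1) by (rule comm_group_P_add)
  interpret R: normal ?R ?P using subgroup_R_sub [OF assms(1)] by (rule P.subgroup_imp_normal)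
  note e = basis_elem_closed [OF assms(1), of \<alpha>]
  have \<beta>\<sigma>: "\<beta> # \<sigma> \<in> diamond \<alpha>"
    using succ.prems by (simp add: Cons_mem_diamond osucc_le_iff)
  then have "?R #>\<^bsub>?P\<^esub> ?e (\<beta> # \<sigma>) \<in> p_pow p (D_grp p \<alpha>) \<beta>"
    by (rule succ.IH) simp
  moreover have "?R #>\<^bsub>?P\<^esub> ?e \<sigma> = (?R #>\<^bsub>?P\<^esub> ?e (\<beta> # \<sigma>)) [^]\<^bsub>D_grp p \<alpha>\<^esub> p"
  proof -
    have "?e (\<beta> # \<sigma>) [^]\<^bsub>?P\<^esub> p \<otimes>\<^bsub>?P\<^esub> inv\<^bsub>?P\<^esub> ?e \<sigma> \<in> ?R"
      using relator_in_R_sub [OF \<beta>\<sigma>, of p] by (simp add: relator_eq [OF assms(1) \<beta>\<sigma>])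
    then have "?e (\<beta> # \<sigma>) [^]\<^bsub>?P\<^esub> p \<in> ?R #>\<^bsub>?P\<^esub> ?e \<sigma>"
      using e P.nat_pow_closed by (intro R.rcos_module_rev P.is_group) auto
    then have "?R #>\<^bsub>?P\<^esub> ?e \<sigma> = ?R #>\<^bsub>?P\<^esub> (?e (\<beta> # \<sigma>) [^]\<^bsub>?P\<^esub> p)"
      using e by (intro P.repr_independence R.subgroup_axioms) auto
    also have "\<dots> = (?R #>\<^bsub>?P\<^esub> ?e (\<beta> # \<sigma>)) [^]\<^bsub>D_grp p \<alpha>\<^esub> p"
      using e by (simp add: D_grp_def R.FactGroup_pow)
    finally show ?thesis .
  qed
  ultimately show ?case
    unfolding p_pow_osucc by blast
qed

text \<open>The coefficient of the basis vector at \<sigma> itself is 1/p, which is not an integer.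
  With the previous lemma, its height is exactly \<open>hd \<sigma>\<close>.\<close>

lemma basis_elem_not_mem_p_pow:
  fixes \<alpha> :: "'o::{wellorder,no_top}"
  assumes "1 < p" "\<sigma> \<in> diamond \<alpha>"
  shows "R_sub p \<alpha> #>\<^bsub>P_add p \<alpha>\<^esub> basis_elem p \<alpha> \<sigma> \<notin> p_pow p (D_grp p \<alpha>) (osucc (hd \<sigma>))"
proof
  assume *: "R_sub p \<alpha> #>\<^bsub>P_add p \<alpha>\<^esub> basis_elem p \<alpha> \<sigma> \<in> p_pow p (D_grp p \<alpha>) (osucc (hd \<sigma>))"
  have "supp \<alpha> (basis_elem p \<alpha> \<sigma>) \<subseteq> {\<sigma>}"
    by (auto simp: supp_def basis_elem_apply)
  then have "relator_coeff p \<alpha> (basis_elem p \<alpha> \<sigma>) \<sigma> \<in> \<int>"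
    using assms basis_elem_closed [of p \<alpha> \<sigma>]
    by (intro p_pow_D_grp_relator_coeff [OF _ _ _ *]) (auto intro: finite_subset)
  then have "1 / real p \<in> \<int>"
    using assms by (simp add: relator_coeff_basis_elem)
  then obtain k :: int where "1 / real p = of_int k" by (auto elim: Ints_cases)
  then have "0 < real_of_int k" "real_of_int k < 1" using assms(1) by (simp_all flip: \<open>1 / real p = of_int k\<close>)
  then show False by simp
qed


section \<open>The groups \<open>E\<^sub>\<alpha>\<close> and their supported product\<close>

lemma comm_group_E_grp: "0 < p \<Longrightarrow> comm_group (E_grp p \<alpha>)"
  unfolding E_grp_def
  by (intro comm_group.abelian_FactGroup comm_group.subgroup_p_pow comm_group_D_grp)

lemma shift_solvable_E_grp: "0 < p \<Longrightarrow> shift_solvable p (E_grp p \<alpha>)"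
  unfolding E_grp_def D_grp_def
  by (intro shift_solvable_Mod shift_solvable_P_add comm_group.subgroup_p_pow
      comm_group.abelian_FactGroup comm_group_P_add subgroup_R_sub)

lemma p_pow_E_grp: "0 < p \<Longrightarrow> p_pow p (E_grp p \<alpha>) \<alpha> = {\<one>\<^bsub>E_grp p \<alpha>\<^esub>}"
  unfolding E_grp_def by (intro comm_group.p_pow_Mod_p_pow_trivial comm_group_D_grp)

text \<open>The witness is the class of the basis vector at \<open>[\<nu>]\<close>: its height in
  \<open>D_grp\<close> is \<nu>, so dividing by the multiple at \<open>osucc \<nu>\<close> does not
  kill it.\<close>

lemma p_pow_E_grp_osucc_nontrivial:
  assumes "1 < p"
  obtains e where "e \<in> p_pow p (E_grp p (osucc \<nu>)) \<nu>" "e \<noteq> \<one>\<^bsub>E_grp p (osucc \<nu>)\<^esub>"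
proof
  let ?\<alpha> = "osucc \<nu>"
  let ?D = "D_grp p ?\<alpha>" and ?d = "R_sub p ?\<alpha> #>\<^bsub>P_add p ?\<alpha>\<^esub> basis_elem p ?\<alpha> [\<nu>]"
  let ?N = "p_pow p ?D ?\<alpha>"
  have p: "0 < p" using assms by simp
  interpret D: comm_group ?D using p by (rule comm_group_D_grp)
  have \<nu>: "[\<nu>] \<in> diamond ?\<alpha>" by (simp add: diamond_def)
  have d: "?d \<in> p_pow p ?D \<nu>" using basis_elem_mem_p_pow [OF p \<nu>, of \<nu>] by simp
  then show "?N #>\<^bsub>?D\<^esub> ?d \<in> p_pow p (E_grp p ?\<alpha>) \<nu>"
    unfolding E_grp_def by (intro D.r_coset_mem_p_pow_Mod D.subgroup_p_pow)
  show "?N #>\<^bsub>?D\<^esub> ?d \<noteq> \<one>\<^bsub>E_grp p ?\<alpha>\<^esub>"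
    using basis_elem_not_mem_p_pow [OF assms \<nu>] D.rcos_self [OF D.p_pow_closed [OF d] D.subgroup_p_pow [of p ?\<alpha>]]
    by (auto simp: E_grp_def)
qed

section \<open>Sets of cardinality below \<kappa>\<close>

lemma Field_ordinal_rel: "Field (ordinal_rel \<kappa>) = {..<\<kappa>}"
  by (force simp: Field_def ordinal_rel_def)

context
  fixes \<kappa> :: "'o::{wellorder,no_top}"
  assumes \<kappa>: "regular_uncountable_cardinal \<kappa>"
begin

lemma Card_order_\<kappa>: "Card_order (ordinal_rel \<kappa>)"
  and natLeq_less_\<kappa>: "natLeq <o ordinal_rel \<kappa>"
  using \<kappa> by (auto simp: regular_uncountable_cardinal_def)

lemma infinite_\<kappa>: "infinite (Field (ordinal_rel \<kappa>))"
  using cinfinite_mono [OF ordLess_imp_ordLeq [OF natLeq_less_\<kappa>] natLeq_cinfinite]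
  by (simp add: cinfinite_def)

lemma small_finite: "finite B \<Longrightarrow> |B| <o ordinal_rel \<kappa>"
  using finite_iff_ordLess_natLeq natLeq_less_\<kappa> ordLess_transitive by blast

lemma small_subset: "|B| <o ordinal_rel \<kappa> \<Longrightarrow> C \<subseteq> B \<Longrightarrow> |C| <o ordinal_rel \<kappa>"
  using card_of_mono1 ordLeq_ordLess_trans by blast

lemma small_Un: "|B| <o ordinal_rel \<kappa> \<Longrightarrow> |C| <o ordinal_rel \<kappa> \<Longrightarrow> |B \<union> C| <o ordinal_rel \<kappa>"
  using card_of_Un_ordLess_infinite_Field [OF infinite_\<kappa> Card_order_\<kappa>] .

text \<open>Regularity of \<kappa> applies because the index set is countable and \<kappa> is
  not.\<close>

lemma small_UN_nat: "(\<And>i::nat. |B i| <o ordinal_rel \<kappa>) \<Longrightarrow> |\<Union>i. B i| <o ordinal_rel \<kappa>"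
  using card_of_UNION_ordLess_infinite_Field_regularCard [of "ordinal_rel \<kappa>" "UNIV :: nat set" B]
    \<kappa> infinite_\<kappa> ordIso_ordLess_trans [OF card_of_nat natLeq_less_\<kappa>]
  by (auto simp: regular_uncountable_cardinal_def cinfinite_def)

lemma small_lessThan:
  assumes "\<beta> < \<kappa>"
  shows "|{..<\<beta>}| <o ordinal_rel \<kappa>"
proof -
  have "underS (ordinal_rel \<kappa>) \<beta> = {..<\<beta>}"
    using assms by (auto simp: underS_def ordinal_rel_def)
  then show ?thesis
    using card_of_underS [OF Card_order_\<kappa>, of \<beta>] assms by (simp add: Field_ordinal_rel)
qed

lemma not_small_\<kappa>: "\<not> |{..<\<kappa>}| <o ordinal_rel \<kappa>"
  using card_of_Field_ordIso [OF Card_order_\<kappa>] not_ordLess_ordIso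
  unfolding Field_ordinal_rel by blast

text \<open>Otherwise \<kappa> would have the elements below \<nu> and one more, a set of
  cardinality below \<kappa>.\<close>

lemma osucc_less_\<kappa>:
  assumes "\<nu> < \<kappa>"
  shows "osucc \<nu> < \<kappa>"
proof (rule ccontr)
  assume "\<not> osucc \<nu> < \<kappa>"
  then have "{..<\<kappa>} \<subseteq> {..<\<nu>} \<union> {\<nu>}"
    by (auto simp: not_less) (metis less_osucc_iff order_le_less order_less_le_trans)
  then show False
    using small_Un [OF small_lessThan [OF assms] small_finite, of "{\<nu>}"] not_small_\<kappa> small_subset by blast
qed

section \<open>Products with small supports\<close>

context
  fixes X :: "'i set" and G :: "'i \<Rightarrow> ('a, 'b) monoid_scheme"
  assumes G: "\<And>x. x \<in> X \<Longrightarrow> comm_group (G x)"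
begin

lemma group_G: "x \<in> X \<Longrightarrow> group (G x)"
  using G comm_group.axioms(2) by blast

lemma supported_product_carrier:
  "f \<in> carrier (supported_product \<kappa> X G) \<longleftrightarrow>
    f \<in> (\<Pi>\<^sub>E x\<in>X. carrier (G x)) \<and> |{x \<in> X. f x \<noteq> \<one>\<^bsub>G x\<^esub>}| <o ordinal_rel \<kappa>"
  by (simp add: supported_product_def)

lemma supported_product_ops:
  "f \<otimes>\<^bsub>supported_product \<kappa> X G\<^esub> g = (\<lambda>x\<in>X. f x \<otimes>\<^bsub>G x\<^esub> g x)"
  "\<one>\<^bsub>supported_product \<kappa> X G\<^esub> = (\<lambda>x\<in>X. \<one>\<^bsub>G x\<^esub>)"
  by (simp_all add: supported_product_def)

lemma nat_pow_supported_product: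
  "f [^]\<^bsub>supported_product \<kappa> X G\<^esub> (n::nat) = (\<lambda>x\<in>X. f x [^]\<^bsub>G x\<^esub> n)"
proof (induction n)
  case 0
  show ?case by (simp add: supported_product_ops)
next
  case (Suc n)
  show ?case unfolding nat_pow_Suc Suc by (auto simp: supported_product_ops)
qed

lemma comm_group_supported_product: "comm_group (supported_product \<kappa> X G)"
proof -
  let ?P = "product_group X G"
  let ?H = "{f \<in> carrier ?P. |{x \<in> X. f x \<noteq> \<one>\<^bsub>G x\<^esub>}| <o ordinal_rel \<kappa>}"
  interpret P: group ?P using group_G by simp
  have "subgroup ?H ?P"
  proof (rule P.subgroupI)
    show "?H \<noteq> {}"
    proof -
      have "\<one>\<^bsub>?P\<^esub> \<in> ?H" using P.one_closed by (simp add: small_finite del: carrier_product_group)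
      then show ?thesis by blast
    qed
  next
    fix f assume f: "f \<in> ?H"
    then have "inv\<^bsub>?P\<^esub> f = (\<lambda>x\<in>X. inv\<^bsub>G x\<^esub> f x)"
      using group_G by (intro inv_product_group) auto
    then have "{x \<in> X. (inv\<^bsub>?P\<^esub> f) x \<noteq> \<one>\<^bsub>G x\<^esub>} \<subseteq> {x \<in> X. f x \<noteq> \<one>\<^bsub>G x\<^esub>}"
      using group_G by (auto simp: group.is_monoid monoid.inv_one)
    then show "inv\<^bsub>?P\<^esub> f \<in> ?H"
      using f P.inv_closed small_subset by blast
  next
    fix f g assume fg: "f \<in> ?H" "g \<in> ?H"
    have "{x \<in> X. (f \<otimes>\<^bsub>?P\<^esub> g) x \<noteq> \<one>\<^bsub>G x\<^esub>} \<subseteq> {x \<in> X. f x \<noteq> \<one>\<^bsub>G x\<^esub>} \<union> {x \<in> X. g x \<noteq> \<one>\<^bsub>G x\<^esub>}"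
      using group_G by (auto simp: group.is_monoid monoid.l_one)
    moreover have "|{x \<in> X. f x \<noteq> \<one>\<^bsub>G x\<^esub>} \<union> {x \<in> X. g x \<noteq> \<one>\<^bsub>G x\<^esub>}| <o ordinal_rel \<kappa>"
      using fg by (intro small_Un) auto
    ultimately show "f \<otimes>\<^bsub>?P\<^esub> g \<in> ?H"
      using fg P.m_closed small_subset by blast
  qed auto
  then have "group (supported_product \<kappa> X G)"
    unfolding supported_product_def by (rule P.subgroup_imp_group)
  then show ?thesis
  proof (rule group.group_comm_groupI)
    fix f g assume "f \<in> carrier (supported_product \<kappa> X G)" "g \<in> carrier (supported_product \<kappa> X G)"
    then show "f \<otimes>\<^bsub>supported_product \<kappa> X G\<^esub> g = g \<otimes>\<^bsub>supported_product \<kappa> X G\<^esub> f"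
      unfolding supported_product_ops supported_product_carrier
      by (intro restrict_ext) (auto intro!: comm_monoid.m_comm comm_group.axioms(1) G)
  qed
qed

lemma p_pow_supported_product:
  fixes \<beta> :: "'c::{wellorder,no_top}"
  shows "f \<in> p_pow p (supported_product \<kappa> X G) \<beta> \<longleftrightarrow>
    f \<in> carrier (supported_product \<kappa> X G) \<and> (\<forall>x\<in>X. f x \<in> p_pow p (G x) \<beta>)"
proof (induction \<beta> arbitrary: f rule: ordinal_induct)
  case (zero \<beta>)
  then show ?case by (auto simp: p_pow_zero supported_product_carrier)
next
  case (limit \<beta>)
  \<comment> \<open>The intersection has a nonempty index set, so the carrier condition can be
    extracted from it.\<close>
  then obtain \<gamma> where "\<gamma> < \<beta>" by (auto simp: is_limit_def)
  with limit show ?case by (auto simp: p_pow_limit)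
next
  case (succ \<beta>)
  let ?A = "supported_product \<kappa> X G"
  interpret A: comm_group ?A by (rule comm_group_supported_product)
  show ?case
  proof
    assume "f \<in> p_pow p ?A (osucc \<beta>)"
    then obtain g where "g \<in> p_pow p ?A \<beta>" "f = g [^]\<^bsub>?A\<^esub> p"
      unfolding p_pow_osucc by blast
    then show "f \<in> carrier ?A \<and> (\<forall>x\<in>X. f x \<in> p_pow p (G x) (osucc \<beta>))"
      using succ A.nat_pow_closed [of g p] by (auto simp: nat_pow_supported_product p_pow_osucc)
  next
    assume f: "f \<in> carrier ?A \<and> (\<forall>x\<in>X. f x \<in> p_pow p (G x) (osucc \<beta>))"
    \<comment> \<open>A trivial component gets the trivial root, so the chosen root has support
      inside that of f and remains small.\<close>
    have "\<exists>a. a \<in> p_pow p (G x) \<beta> \<and> f x = a [^]\<^bsub>G x\<^esub> p \<and> (f x = \<one>\<^bsub>G x\<^esub> \<longrightarrow> a = \<one>\<^bsub>G x\<^esub>)"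
      if x: "x \<in> X" for x
    proof (cases "f x = \<one>\<^bsub>G x\<^esub>")
      case True
      interpret Gx: comm_group "G x" using x by (rule G)
      show ?thesis
        using True subgroup.one_closed [OF Gx.subgroup_p_pow] by (intro exI [of _ "\<one>\<^bsub>G x\<^esub>"]) simp
    next
      case False
      with f x show ?thesis by (auto simp: p_pow_osucc)
    qed
    then obtain g where g: "\<And>x. x \<in> X \<Longrightarrow> g x \<in> p_pow p (G x) \<beta>"
        "\<And>x. x \<in> X \<Longrightarrow> f x = g x [^]\<^bsub>G x\<^esub> p" "\<And>x. x \<in> X \<Longrightarrow> f x = \<one>\<^bsub>G x\<^esub> \<Longrightarrow> g x = \<one>\<^bsub>G x\<^esub>"
      by metis
    have "restrict g X \<in> carrier ?A"
    proof -
      have "|{x \<in> X. restrict g X x \<noteq> \<one>\<^bsub>G x\<^esub>}| <o ordinal_rel \<kappa>"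
        by (rule small_subset [of "{x \<in> X. f x \<noteq> \<one>\<^bsub>G x\<^esub>}"])
          (use f g(3) in \<open>auto simp: supported_product_carrier\<close>)
      then show ?thesis
        using comm_group.p_pow_closed [OF G g(1)] by (auto simp: supported_product_carrier)
    qed
    then have "restrict g X \<in> p_pow p ?A \<beta>"
      unfolding succ using g(1) by (metis restrict_apply')
    moreover have "f = restrict g X [^]\<^bsub>?A\<^esub> p"
    proof
      show "f x = (restrict g X [^]\<^bsub>?A\<^esub> p) x" for x
        using f g(2) [of x]
        by (cases "x \<in> X") (auto simp: nat_pow_supported_product supported_product_carrier PiE_iff
            extensional_def)
    qed
    ultimately show "f \<in> p_pow p ?A (osucc \<beta>)"
      unfolding p_pow_osucc by blast
  qed
qed

lemma shift_solvable_supported_product: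
  assumes "\<And>x. x \<in> X \<Longrightarrow> shift_solvable p (G x)"
  shows "shift_solvable p (supported_product \<kappa> X G)"
  unfolding shift_solvable_def
proof (intro allI impI)
  let ?A = "supported_product \<kappa> X G"
  fix a :: "nat \<Rightarrow> 'i \<Rightarrow> 'a" assume "\<forall>i. a i \<in> carrier ?A"
  then have a: "a i \<in> carrier ?A" for i by simp
  \<comment> \<open>Componentwise solutions are taken trivial off B; every entry of the solution is
    then supported in this one small set.\<close>
  define B where "B = (\<Union>i. {x \<in> X. a i x \<noteq> \<one>\<^bsub>G x\<^esub>})"
  have small_B: "|B| <o ordinal_rel \<kappa>"
    unfolding B_def using a by (intro small_UN_nat) (simp add: supported_product_carrier)
  have "\<exists>y. \<forall>i. y i \<in> carrier (G x) \<and> y i = a i x \<otimes>\<^bsub>G x\<^esub> y (Suc i) [^]\<^bsub>G x\<^esub> p \<and>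
      (x \<notin> B \<longrightarrow> y i = \<one>\<^bsub>G x\<^esub>)" if x: "x \<in> X" for x
  proof (cases "x \<in> B")
    case True
    have "\<forall>i. a i x \<in> carrier (G x)" using a x by (auto simp: supported_product_carrier)
    with spec [OF assms [OF x, unfolded shift_solvable_def], of "\<lambda>i. a i x"] True
    show ?thesis by simp
  next
    case False
    interpret Gx: comm_group "G x" using x by (rule G)
    have "a i x = \<one>\<^bsub>G x\<^esub>" for i using False x by (auto simp: B_def)
    then show ?thesis by (intro exI [of _ "\<lambda>i. \<one>\<^bsub>G x\<^esub>"]) simp
  qed
  then obtain y where y: "\<And>x i. x \<in> X \<Longrightarrow> y x i \<in> carrier (G x)"
      "\<And>x i. x \<in> X \<Longrightarrow> y x i = a i x \<otimes>\<^bsub>G x\<^esub> y x (Suc i) [^]\<^bsub>G x\<^esub> p"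
      "\<And>x i. x \<in> X \<Longrightarrow> x \<notin> B \<Longrightarrow> y x i = \<one>\<^bsub>G x\<^esub>"
    by metis
  define z where "z i = (\<lambda>x\<in>X. y x i)" for i
  have "|{x \<in> X. z i x \<noteq> \<one>\<^bsub>G x\<^esub>}| <o ordinal_rel \<kappa>" for i
    using small_B by (rule small_subset) (use y(3) in \<open>auto simp: z_def\<close>)
  then have mem: "z i \<in> carrier ?A" for i
    using y(1) by (simp add: supported_product_carrier z_def)
  have eq: "z i = a i \<otimes>\<^bsub>?A\<^esub> z (Suc i) [^]\<^bsub>?A\<^esub> p" for i
    unfolding supported_product_ops nat_pow_supported_product z_def
    by (intro restrict_ext, subst y(2)) simp_all
  show "\<exists>z. \<forall>i. z i \<in> carrier ?A \<and> z i = a i \<otimes>\<^bsub>?A\<^esub> z (Suc i) [^]\<^bsub>?A\<^esub> p"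
    by (intro exI [of _ z] allI conjI mem eq)
qed

end

end

text \<open>Computes the transition maps of the completion on cosets; it serves to check that the
  truncations form a compatible family.\<close>

lemma (in comm_group) set_mult_rcos_eq:
  assumes "subgroup H G" "subgroup K G" "K \<subseteq> H" "x \<in> carrier G" "y \<in> H #> x"
  shows "H <#> (K #> y) = H #> x"
proof -
  have y: "y \<in> carrier G"
    using subgroup.elemrcos_carrier [OF assms(1) is_group assms(4,5)] .
  have "H <#> K = H"
    using subgroup_mult_id [OF assms(1)] assms(3) mono_set_mult [of H H K H G]
      subgroup.one_closed [OF assms(2)] subgroup.subset [OF assms(1)]
    by (force simp: set_mult_def)
  then have "H <#> (K #> y) = H #> y"
    using setmult_rcos_assoc [OF subgroup.subset subgroup.subset y] assms(1,2) by simp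
  then show ?thesis
    using repr_independence [OF assms(5,4,1)] by simp
qed

section \<open>Locality, length and failure of completeness\<close>

theorem theorem5p8:
  fixes p :: nat and \<kappa> :: "'o::{wellorder,no_top}"
  assumes "Factorial_Ring.prime p"
    and "regular_uncountable_cardinal \<kappa>"
  shows "let A = supported_product \<kappa> {..<\<kappa>} (\<lambda>\<alpha>. E_grp p (osucc \<alpha>));
             S = mult_seq p A
         in local_seq S \<and> \<not> complete_at S \<kappa> \<and> has_len S \<kappa>"
proof -
  note \<kappa> = assms(2)
  have p: "1 < p" using assms(1) by (rule prime_gt_1_nat)
  then have p0: "0 < p" by simp
  let ?E = "\<lambda>\<alpha>. E_grp p (osucc \<alpha>)"
  define A where "A = supported_product \<kappa> {..<\<kappa>} ?E"
  let ?S = "mult_seq p A"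
  note E = comm_group_E_grp [OF p0]
  interpret A: comm_group A
    unfolding A_def using \<kappa> E by (rule comm_group_supported_product)
  have A_carrier: "f \<in> carrier A \<longleftrightarrow> f \<in> (\<Pi>\<^sub>E \<alpha>\<in>{..<\<kappa>}. carrier (?E \<alpha>)) \<and>
      |{\<alpha> \<in> {..<\<kappa>}. f \<alpha> \<noteq> \<one>\<^bsub>?E \<alpha>\<^esub>}| <o ordinal_rel \<kappa>" for f
    unfolding A_def using \<kappa> E by (rule supported_product_carrier)
  have A_ops: "f \<otimes>\<^bsub>A\<^esub> g = (\<lambda>\<alpha>\<in>{..<\<kappa>}. f \<alpha> \<otimes>\<^bsub>?E \<alpha>\<^esub> g \<alpha>)" "\<one>\<^bsub>A\<^esub> = (\<lambda>\<alpha>\<in>{..<\<kappa>}. \<one>\<^bsub>?E \<alpha>\<^esub>)" for f g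
    unfolding A_def by (rule supported_product_ops [OF \<kappa> E])+
  have A_p_pow: "f \<in> p_pow p A \<beta> \<longleftrightarrow> f \<in> carrier A \<and> (\<forall>\<alpha>\<in>{..<\<kappa>}. f \<alpha> \<in> p_pow p (?E \<alpha>) \<beta>)"
    for f and \<beta> :: 'o
    unfolding A_def using \<kappa> E by (rule p_pow_supported_product)
  have E_trivial: "p_pow p (?E \<alpha>) \<beta> = {\<one>\<^bsub>?E \<alpha>\<^esub>}" if "\<alpha> < \<beta>" for \<alpha> \<beta> :: 'o
  proof -
    interpret E: comm_group "?E \<alpha>" by (rule E)
    show ?thesis
      using E.p_pow_antimono [of "osucc \<alpha>" \<beta> p] p_pow_E_grp [OF p0, of "osucc \<alpha>"]
        subgroup.one_closed [OF E.subgroup_p_pow, of p \<beta>] that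
      by (auto simp: osucc_le_iff)
  qed
  \<comment> \<open>Every index \<alpha> is below \<kappa>, so every component vanishes by
    \<open>E_trivial\<close>.\<close>
  have A_trivial: "p_pow p A \<kappa> = {\<one>\<^bsub>A\<^esub>}"
  proof -
    have "f = \<one>\<^bsub>A\<^esub>" if "f \<in> p_pow p A \<kappa>" for f
      using that by (auto simp: A_p_pow A_carrier A_ops E_trivial PiE_iff extensional_def fun_eq_iff)
    then show ?thesis using subgroup.one_closed [OF A.subgroup_p_pow] by blast
  qed
  have "\<exists>e. e \<in> p_pow p (?E \<nu>) \<nu> \<and> e \<noteq> \<one>\<^bsub>?E \<nu>\<^esub>" for \<nu> :: 'o
    using p_pow_E_grp_osucc_nontrivial [OF p] by metis
  then obtain e where e: "\<And>\<nu> :: 'o. e \<nu> \<in> p_pow p (?E \<nu>) \<nu>" "\<And>\<nu> :: 'o. e \<nu> \<noteq> \<one>\<^bsub>?E \<nu>\<^esub>"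
    by metis
  \<comment> \<open>The part of the family e supported on B, an element of A as soon as B is
    small.\<close>
  define a where "a B = (\<lambda>\<nu>\<in>{..<\<kappa>}. if \<nu> \<in> B then e \<nu> else \<one>\<^bsub>?E \<nu>\<^esub>)" for B
  have a_mem: "a B \<in> carrier A" if "|B| <o ordinal_rel \<kappa>" for B
  proof -
    have "|{\<alpha> \<in> {..<\<kappa>}. a B \<alpha> \<noteq> \<one>\<^bsub>?E \<alpha>\<^esub>}| <o ordinal_rel \<kappa>"
      by (rule small_subset [OF \<kappa> that]) (auto simp: a_def)
    then show ?thesis
      using comm_group.p_pow_closed [OF E e(1)] E [of "_ :: 'o"]
      by (auto simp: A_carrier a_def comm_group_def group.is_monoid)
  qed
  have a_p_pow: "a B \<in> p_pow p A \<gamma>" if "|B| <o ordinal_rel \<kappa>" "B \<subseteq> {\<gamma>..}" for B \<gamma>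
  proof -
    \<comment> \<open>A nontrivial component has \<nu> \<ge> \<gamma>, and \<open>e \<nu>\<close>
      has height at least \<nu>.\<close>
    have "a B \<nu> \<in> p_pow p (?E \<nu>) \<gamma>" if "\<nu> < \<kappa>" for \<nu>
    proof -
      interpret E: comm_group "?E \<nu>" by (rule E)
      show ?thesis
        using E.p_pow_antimono [of \<gamma> \<nu> p] subgroup.one_closed [OF E.subgroup_p_pow, of p \<gamma>]
          e(1) [of \<nu>] that \<open>B \<subseteq> {\<gamma>..}\<close>
        by (auto simp: a_def)
    qed
    with a_mem [OF that(1)] show ?thesis by (simp add: A_p_pow)
  qed
  have "local_seq ?S"
  proof (rule local_mult_seqI [OF A.comm_group_axioms A_trivial])
    show "shift_solvable p A"
      unfolding A_def using \<kappa> E shift_solvable_E_grp [OF p0] by (rule shift_solvable_supported_product)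
  qed
  moreover have "has_len ?S \<kappa>"
    unfolding has_len_def
  proof (intro conjI allI impI)
    have "I_grp ?S \<beta> i = I_grp ?S \<kappa> i" if "\<kappa> < \<beta>" for \<beta> :: 'o and i
    proof -
      have "p_pow p A \<beta> = p_pow p A \<kappa>"
        using A.p_pow_antimono [OF less_imp_le [OF that], of p] subgroup.one_closed [OF A.subgroup_p_pow, of p \<beta>]
        unfolding A_trivial by auto
      then show ?thesis by (simp add: I_grp_def I_pow_mult_seq)
    qed
    then show "stable_at ?S \<kappa>"
      by (simp add: stable_at_def iso_set_refl)
  next
    fix \<nu> :: 'o assume stable: "stable_at ?S \<nu>"
    show "\<kappa> \<le> \<nu>"
    proof (rule ccontr)
      assume "\<not> \<kappa> \<le> \<nu>"
      then have \<nu>: "\<nu> < \<kappa>" by simp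
      with stable have "(\<lambda>x. x) \<in> iso (I_grp ?S \<kappa> 0) (I_grp ?S \<nu> 0)"
        by (simp add: stable_at_def)
      then have "p_pow p A \<kappa> = p_pow p A \<nu>"
        by (auto simp: iso_def I_grp_def I_pow_mult_seq bij_betw_def)
      \<comment> \<open>A nonzero element of the multiple at \<nu>, whereas the multiple at \<kappa>
        is zero.\<close>
      moreover have "a {\<nu>} \<in> p_pow p A \<nu>"
        using small_finite [OF \<kappa>, of "{\<nu>}"] by (intro a_p_pow) auto
      ultimately have "a {\<nu>} = \<one>\<^bsub>A\<^esub>" unfolding A_trivial by blast
      then have "a {\<nu>} \<nu> = \<one>\<^bsub>A\<^esub> \<nu>" by simp
      then show False
        using \<nu> e(2) by (simp add: A_ops a_def)
    qed
  qed
  moreover have "\<not> complete_at ?S \<kappa>"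
  proof
    let ?N = "p_pow p A"
    \<comment> \<open>Each truncation below \<beta> < \<kappa> has small support, although the whole
      family does not.\<close>
    let ?b = "\<lambda>\<beta>. a {..<\<beta>}"
    have b_mem: "?b \<beta> \<in> carrier A" if "\<beta> < \<kappa>" for \<beta>
      by (intro a_mem small_lessThan \<kappa> that)
    \<comment> \<open>Two truncations differ by the part of e on the interval from \<gamma> to
      \<beta>, which has height at least \<gamma>.\<close>
    have b_coset: "?b \<beta> \<in> ?N \<gamma> #>\<^bsub>A\<^esub> ?b \<gamma>" if "\<gamma> < \<beta>" "\<beta> < \<kappa>" for \<beta> \<gamma>
    proof -
      have "|{\<gamma>..<\<beta>}| <o ordinal_rel \<kappa>"
        by (rule small_subset [OF \<kappa> small_lessThan [OF \<kappa> that(2)]]) auto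
      then have "a {\<gamma>..<\<beta>} \<in> ?N \<gamma>" by (rule a_p_pow) auto
      moreover have "?b \<beta> = a {\<gamma>..<\<beta>} \<otimes>\<^bsub>A\<^esub> ?b \<gamma>"
      proof
        fix \<nu> :: 'o
        interpret E: comm_group "?E \<nu>" by (rule E)
        show "?b \<beta> \<nu> = (a {\<gamma>..<\<beta>} \<otimes>\<^bsub>A\<^esub> ?b \<gamma>) \<nu>"
          using E.p_pow_closed [OF e(1)] that by (auto simp: A_ops a_def)
      qed
      ultimately show ?thesis by (auto simp: r_coset_def)
    qed
    assume "complete_at ?S \<kappa>"
    then have onto: "to_completion ?S \<kappa> 0 ` carrier A = carrier (completion ?S \<kappa> 0)"
      by (simp add: complete_at_def mult_seq_def)
    have "(\<lambda>\<beta>\<in>{..<\<kappa>}. ?N \<beta> #>\<^bsub>A\<^esub> ?b \<beta>) \<in> carrier (completion ?S \<kappa> 0)"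
    proof -
      have "?N \<beta> #>\<^bsub>A\<^esub> ?b \<beta> \<in> carrier (seq_quot ?S \<beta> 0)" if "\<beta> < \<kappa>" for \<beta>
        unfolding seq_quot_def I_pow_mult_seq using b_mem [OF that]
        by (simp add: carrier_FactGroup mult_seq_def)
      moreover have "?N \<gamma> <#>\<^bsub>A\<^esub> (?N \<beta> #>\<^bsub>A\<^esub> ?b \<beta>) = ?N \<gamma> #>\<^bsub>A\<^esub> ?b \<gamma>" if "\<beta> < \<kappa>" "\<gamma> < \<beta>" for \<beta> \<gamma>
        using that A.p_pow_antimono [of \<gamma> \<beta> p] b_mem [of \<gamma>] b_coset [of \<gamma> \<beta>]
        by (intro A.set_mult_rcos_eq A.subgroup_p_pow) auto
      ultimately show ?thesis
        unfolding completion_def I_pow_mult_seq by (auto simp: mult_seq_def)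
    qed
    then obtain x where x: "x \<in> carrier A" "to_completion ?S \<kappa> 0 x = (\<lambda>\<beta>\<in>{..<\<kappa>}. ?N \<beta> #>\<^bsub>A\<^esub> ?b \<beta>)"
      unfolding onto [symmetric] by (elim imageE) simp
    \<comment> \<open>Stage \<open>osucc \<nu>\<close> decides component \<nu>: its truncation
      includes \<open>e \<nu>\<close>, and the coset leaves no freedom there because the multiple at
      \<open>osucc \<nu>\<close> is trivial in that component.\<close>
    have "x \<nu> = e \<nu>" if \<nu>: "\<nu> < \<kappa>" for \<nu>
    proof -
      let ?\<beta> = "osucc \<nu>"
      have \<beta>: "?\<beta> < \<kappa>" using \<kappa> \<nu> by (rule osucc_less_\<kappa>)
      have "?N ?\<beta> #>\<^bsub>A\<^esub> x = ?N ?\<beta> #>\<^bsub>A\<^esub> ?b ?\<beta>"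
        using fun_cong [OF x(2), of ?\<beta>] \<beta> by (simp add: to_completion_def I_pow_mult_seq) (simp add: mult_seq_def)
      then have "x \<in> ?N ?\<beta> #>\<^bsub>A\<^esub> ?b ?\<beta>"
        using A.rcos_self [OF x(1) A.subgroup_p_pow, of p ?\<beta>] by simp
      then obtain n where n: "n \<in> ?N ?\<beta>" "x = n \<otimes>\<^bsub>A\<^esub> ?b ?\<beta>"
        by (auto simp: r_coset_def)
      interpret E: comm_group "?E \<nu>" by (rule E)
      have "n \<nu> = \<one>\<^bsub>?E \<nu>\<^esub>"
        using n(1) \<nu> E_trivial [of \<nu> ?\<beta>] by (auto simp: A_p_pow)
      then show ?thesis
        using n(2) \<nu> E.p_pow_closed [OF e(1)] by (simp add: A_ops a_def)
    qed
    then have "{\<alpha> \<in> {..<\<kappa>}. x \<alpha> \<noteq> \<one>\<^bsub>?E \<alpha>\<^esub>} = {..<\<kappa>}"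
      using e(2) by auto
    then show False
      using x(1) not_small_\<kappa> [OF \<kappa>] by (simp add: A_carrier)
  qed
  ultimately show ?thesis
    by (simp add: Let_def A_def)
qed

end
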